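(* Let $(\Omega,\mathcal{F},\mu)$ be a measure space, $p\in(1,+\infty)$, $k\ge 1$ an integer, and let $X=Y^*$ be the dual space of a Banach space $Y$, such that $X$ has the Radon-Nikodym property and the unit ball of $X$ is $w^*$-sequentially compact. Suppose that the norm of $X$ is Gâteaux differentiable. Then $\mathscr{G}_{p,k}(X)$ is approximatively $w^*$-compact in $L^p(\Omega,\mathcal{F},\mu,X)$.
   Context: A simple function is a function $\sum_{i=1}^n x_i\mathbf{1}_{A_i}$ with $n\ge 1$, $x_i\in X$, $A_i\in\mathcal{F}$. A function $f:\Omega\to X$ is strongly measurable if it is a pointwise limit of a sequence of simple functions. For $1\le p<\infty$, $L^p(X)=L^p(\Omega,\mathcal{F},\mu,X)$ is the Bochner space of strongly measurable $f:\Omega\to X$ with $\int_\Omega\|f\|^p\,d\mu<\infty$ (functions equal a.e. are identified), with norm $\|f\|_p=\left(\int_\Omega\|f\|^p\,d\mu\right)^{1/p}$. $\mathscr{G}_{p,k}(X)$ is the set of all functions $\sum_{i=1}^{l}x_i\mathbf{1}_{A_i}\in L^p(X)$ with $l\le k$, $\{A_i\}_{1\le i\le l}\subset\mathcal{F}$ a partition of $\Omega$, and $x_1,\dots,x_l\in X$. The norm of $X$ is Gâteaux differentiable if it is Gâteaux differentiable at every nonzero point of $X$. A Banach space $X$ has the Radon-Nikodym property (RNP) if for every finite measure space, every $X$-valued countably additive measure of bounded variation that is absolutely continuous with respect to the given measure has a Bochner integrable density. The $w^*$-topology on $X=Y^*$ is the one with respect to $Y$. With $\frac1p+\frac1q=1$,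 the RNP of $X=Y^*$ gives the identification $(L^q(\Omega,\mathcal{F},\mu,Y))^*=L^p(\Omega,\mathcal{F},\mu,X)$ through the pairing $\langle \varphi,h\rangle=\int_\Omega\langle\varphi(w),h(w)\rangle\,\mu(dw)$, and the $w^*$-topology on $L^p(X)$ is the corresponding weak-star topology. For a subset $K$ of a Banach space $Z$ and $z\in Z$, a minimizing sequence for $z$ is a sequence $(w_n)_n\subset K$ with $\|z-w_n\|\to d(z,K)=\inf_{w\in K}\|z-w\|$. $K$ is approximatively $\tau$-compact if for every $z\in Z$, every minimizing sequence for $z$ admits a subnet that $\tau$-converges to a point of $K$. Here $Z=L^p(X)$, $K=\mathscr{G}_{p,k}(X)$ and $\tau=w^*$. *)

theory Defs
  imports "HOL-Analysis.Analysis"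
begin

section \<open>Bochner integration in a possibly nonseparable space\<close>

text \<open>
  The dual of a Banach space need not be separable, so the library's \<open>has_bochner_integral\<close>
  and \<open>integrable\<close>, which require a second countable range, are not available for it.
  The library's \<open>simple_function\<close> (finite range, measurable fibres) is the class of finite sums
  of \<open>x\<^sub>i\<close> times the indicator of a measurable set.
\<close>

definition strongly_measurable :: "'a measure \<Rightarrow> ('a \<Rightarrow> 'b::real_normed_vector) \<Rightarrow> bool" where
  "strongly_measurable M f \<longleftrightarrow>
     (\<exists>s. (\<forall>n. simple_function M (s n)) \<and> (\<forall>w\<in>space M. (\<lambda>n::nat. s n w) \<longlonglongrightarrow> f w))"

text \<open>As \<open>has_bochner_integral\<close>, with strong instead of Borel measurability.\<close>

definition has_strong_bochner_integral ::
    "'a measure \<Rightarrow> ('a \<Rightarrow> 'b::real_normed_vector) \<Rightarrow> 'b \<Rightarrow> bool" where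
  "has_strong_bochner_integral M f x \<longleftrightarrow>
     strongly_measurable M f \<and>
     (\<exists>s. (\<forall>n. Bochner_Integration.simple_bochner_integrable M (s n)) \<and>
          (\<lambda>n::nat. \<integral>\<^sup>+w. ennreal (norm (f w - s n w)) \<partial>M) \<longlonglongrightarrow> 0 \<and>
          (\<lambda>n. Bochner_Integration.simple_bochner_integral M (s n)) \<longlonglongrightarrow> x)"

text \<open>
  Elements of \<open>L\<^sup>p\<close> are represented by functions rather than by almost-everywhere classes:
  the seminorm, the weak-star topology and hence approximative compactness below do not
  distinguish functions that agree almost everywhere.
\<close>

definition Lp :: "'a measure \<Rightarrow> real \<Rightarrow> ('a \<Rightarrow> 'b::real_normed_vector) set" where
  "Lp M p = {f. strongly_measurable M f \<and> (\<integral>\<^sup>+w. ennreal (norm (f w) powr p) \<partial>M) < \<infinity>}"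

definition Lp_norm :: "'a measure \<Rightarrow> real \<Rightarrow> ('a \<Rightarrow> 'b::real_normed_vector) \<Rightarrow> real" where
  "Lp_norm M p f = (\<integral>w. norm (f w) powr p \<partial>M) powr (1 / p)"

definition Lp_dist ::
    "'a measure \<Rightarrow> real \<Rightarrow> ('a \<Rightarrow> 'b::real_normed_vector) \<Rightarrow> ('a \<Rightarrow> 'b) \<Rightarrow> real" where
  "Lp_dist M p f g = Lp_norm M p (\<lambda>w. f w - g w)"

text \<open>Some of the sets \<open>A i\<close> may be empty.\<close>

definition G_set :: "'a measure \<Rightarrow> real \<Rightarrow> nat \<Rightarrow> ('a \<Rightarrow> 'b::real_normed_vector) set" where
  "G_set M p k =
     {g \<in> Lp M p. \<exists>l\<le>k. \<exists>A x.
        (\<forall>i<l. A i \<in> sets M) \<and> disjoint_family_on A {..<l} \<and> (\<Union>i<l. A i) = space M \<and>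
        (\<forall>w\<in>space M. g w = (\<Sum>i<l. indicator (A i) w *\<^sub>R x i))}"

section \<open>The Radon-Nikodym property\<close>

definition vector_measure :: "'w measure \<Rightarrow> ('w set \<Rightarrow> 'b::real_normed_vector) \<Rightarrow> bool" where
  "vector_measure M \<nu> \<longleftrightarrow>
     (\<forall>A::nat \<Rightarrow> 'w set. range A \<subseteq> sets M \<longrightarrow> disjoint_family A \<longrightarrow>
        (\<lambda>n. \<nu> (A n)) sums \<nu> (\<Union>n. A n))"

definition finite_variation :: "'w measure \<Rightarrow> ('w set \<Rightarrow> 'b::real_normed_vector) \<Rightarrow> bool" where
  "finite_variation M \<nu> \<longleftrightarrow>
     (\<exists>C. \<forall>P. finite P \<longrightarrow> P \<subseteq> sets M \<longrightarrow> partition_on (space M) P \<longrightarrow>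
        (\<Sum>A\<in>P. norm (\<nu> A)) \<le> C)"

text \<open>
  The Radon-Nikodym property of \<open>'b\<close> with respect to all finite measure spaces whose points
  lie in \<open>'w\<close>. A formula cannot quantify over all types \<open>'w\<close>. The instance
  \<open>'w = real\<close> covers Lebesgue measure on the unit interval, and is therefore already equivalent
  to the full property (Diestel and Uhl, Vector Measures); further instances are special cases
  of the full property.
\<close>

definition RNP :: "'w itself \<Rightarrow> 'b::real_normed_vector itself \<Rightarrow> bool" where
  "RNP _ _ \<longleftrightarrow>
     (\<forall>(M::'w measure) (\<nu>::'w set \<Rightarrow> 'b).
        finite_measure M \<longrightarrow> vector_measure M \<nu> \<longrightarrow> finite_variation M \<nu> \<longrightarrow>
        (\<forall>A\<in>null_sets M. \<nu> A = 0) \<longrightarrow>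
        (\<exists>f. \<forall>A\<in>sets M. has_strong_bochner_integral M (\<lambda>w. indicator A w *\<^sub>R f w) (\<nu> A)))"

section \<open>Differentiability of the norm\<close>

definition gateaux_differentiable_at ::
    "('b::real_normed_vector \<Rightarrow> real) \<Rightarrow> 'b \<Rightarrow> bool" where
  "gateaux_differentiable_at F x \<longleftrightarrow>
     (\<exists>D. bounded_linear D \<and> (\<forall>h. ((\<lambda>t::real. (F (x + t *\<^sub>R h) - F x) / t) \<longlongrightarrow> D h) (at 0)))"

definition gateaux_differentiable_norm :: "'b::real_normed_vector itself \<Rightarrow> bool" where
  "gateaux_differentiable_norm _ \<longleftrightarrow> (\<forall>x::'b. x \<noteq> 0 \<longrightarrow> gateaux_differentiable_at norm x)"

section \<open>Weak-star topologies\<close>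

text \<open>
  For scalar-valued operators, the strong operator topology is the topology of pointwise
  convergence on \<open>'y\<close>.
\<close>

abbreviation weak_star :: "('y::real_normed_vector \<Rightarrow>\<^sub>L real) topology" where
  "weak_star \<equiv> strong_operator_topology"

text \<open>
  The weak-star topology on \<open>L\<^sup>p\<close> of the dual: the coarsest topology for which integration
  against each \<open>h\<close> in the predual \<open>L\<^sup>q\<close> is continuous.
\<close>

definition Lp_weak_star ::
    "'a measure \<Rightarrow> real \<Rightarrow> real \<Rightarrow> ('a \<Rightarrow> ('y::real_normed_vector \<Rightarrow>\<^sub>L real)) topology" where
  "Lp_weak_star M p q =
     pullback_topology (Lp M p)
       (\<lambda>\<phi>. \<lambda>h\<in>Lp M q. \<integral>w. blinfun_apply (\<phi> w) (h w) \<partial>M)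
       (product_topology (\<lambda>_. euclideanreal) (Lp M q))"

definition seq_compactin :: "'z topology \<Rightarrow> 'z set \<Rightarrow> bool" where
  "seq_compactin T S \<longleftrightarrow>
     (\<forall>f::nat \<Rightarrow> 'z. range f \<subseteq> S \<longrightarrow>
        (\<exists>l\<in>S. \<exists>r::nat \<Rightarrow> nat. strict_mono r \<and> limitin T (f \<circ> r) l sequentially))"

section \<open>Subnets and approximative compactness\<close>

definition directed_by :: "'i set \<Rightarrow> ('i \<Rightarrow> 'i \<Rightarrow> bool) \<Rightarrow> bool" where
  "directed_by D le \<longleftrightarrow>
     D \<noteq> {} \<and> (\<forall>a\<in>D. le a a) \<and>
     (\<forall>a\<in>D. \<forall>b\<in>D. \<forall>c\<in>D. le a b \<longrightarrow> le b c \<longrightarrow> le a c) \<and>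
     (\<forall>a\<in>D. \<forall>b\<in>D. \<exists>c\<in>D. le a c \<and> le b c)"

text \<open>The subnet \<open>d \<mapsto> w (h d)\<close>, indexed by \<open>D\<close>, of the sequence \<open>w\<close> converges to \<open>z\<close>.\<close>

definition subnet_converges ::
    "'i set \<Rightarrow> ('i \<Rightarrow> 'i \<Rightarrow> bool) \<Rightarrow> ('i \<Rightarrow> nat) \<Rightarrow> 'z topology \<Rightarrow> (nat \<Rightarrow> 'z) \<Rightarrow> 'z \<Rightarrow> bool" where
  "subnet_converges D le h T w z \<longleftrightarrow>
     directed_by D le \<and>
     (\<forall>N. \<exists>d0\<in>D. \<forall>d\<in>D. le d0 d \<longrightarrow> N \<le> h d) \<and>
     z \<in> topspace T \<and>
     (\<forall>U. openin T U \<and> z \<in> U \<longrightarrow> (\<exists>d0\<in>D. \<forall>d\<in>D. le d0 d \<longrightarrow> w (h d) \<in> U))"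

text \<open>
  The index type is fixed here only because a formula cannot quantify over types; the lemma
  below shows that a convergent subnet over any index type yields one of this form.
\<close>

definition has_subnet_converging_to :: "'z topology \<Rightarrow> (nat \<Rightarrow> 'z) \<Rightarrow> 'z \<Rightarrow> bool" where
  "has_subnet_converging_to T w z \<longleftrightarrow>
     (\<exists>(D::(nat \<times> 'z set) set) le h. subnet_converges D le h T w z)"

lemma has_subnet_converging_toI:
  fixes D :: "'i set"
  assumes "subnet_converges D le h T w z"
  shows "has_subnet_converging_to T w z"
proof -
  let ?E = "{(n, U). openin T U \<and> z \<in> U \<and> w n \<in> U}"
  let ?le = "\<lambda>a b. fst a \<le> fst b \<and> snd b \<subseteq> snd a"
  have dir: "directed_by D le" and zT: "z \<in> topspace T"
    using assms by (auto simp: subnet_converges_def)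
  have cluster: "\<exists>n\<ge>N. w n \<in> U" if U: "openin T U" "z \<in> U" for N U
  proof -
    obtain a where a: "a \<in> D" "\<forall>d\<in>D. le a d \<longrightarrow> N \<le> h d"
      using assms unfolding subnet_converges_def by blast
    obtain b where b: "b \<in> D" "\<forall>d\<in>D. le b d \<longrightarrow> w (h d) \<in> U"
      using assms U unfolding subnet_converges_def by blast
    obtain c where "c \<in> D" "le a c" "le b c"
      using dir a b unfolding directed_by_def by blast
    with a b show ?thesis by blast
  qed
  have ex: "\<exists>n. N \<le> n \<and> (n, U) \<in> ?E" if "openin T U" "z \<in> U" for N U
    using cluster[OF that] that by auto
  have "directed_by ?E ?le"
    unfolding directed_by_def
  proof (intro conjI ballI impI)
    show "?E \<noteq> {}" using ex[of "topspace T" 0] zT by blast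
  next
    fix a b assume ab: "a \<in> ?E" "b \<in> ?E"
    then have "openin T (snd a \<inter> snd b)" "z \<in> snd a \<inter> snd b" by auto
    from ex[OF this, of "max (fst a) (fst b)"]
    obtain n where "max (fst a) (fst b) \<le> n" "(n, snd a \<inter> snd b) \<in> ?E" by blast
    then show "\<exists>c\<in>?E. ?le a c \<and> ?le b c"
      by (intro bexI[of _ "(n, snd a \<inter> snd b)"]) auto
  qed auto
  moreover have "\<exists>d0\<in>?E. \<forall>d\<in>?E. ?le d0 d \<longrightarrow> N \<le> fst d" for N
  proof -
    obtain n where n: "N \<le> n" "(n, topspace T) \<in> ?E" using ex[of "topspace T" N] zT by blast
    show ?thesis using n(1) by (intro bexI[OF _ n(2)]) auto
  qed
  moreover have "\<exists>d0\<in>?E. \<forall>d\<in>?E. ?le d0 d \<longrightarrow> w (fst d) \<in> U" if U: "openin T U" "z \<in> U" for U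
  proof -
    obtain n where n: "(n, U) \<in> ?E" using ex[OF U] by blast
    show ?thesis by (intro bexI[OF _ n]) auto
  qed
  ultimately have "subnet_converges ?E ?le fst T w z"
    using zT unfolding subnet_converges_def by blast
  then show ?thesis unfolding has_subnet_converging_to_def by blast
qed

definition minimizing_sequence ::
    "('z \<Rightarrow> 'z \<Rightarrow> real) \<Rightarrow> 'z set \<Rightarrow> 'z \<Rightarrow> (nat \<Rightarrow> 'z) \<Rightarrow> bool" where
  "minimizing_sequence d K z w \<longleftrightarrow>
     (\<forall>n. w n \<in> K) \<and> (\<lambda>n. d z (w n)) \<longlonglongrightarrow> (INF u\<in>K. d z u)"

definition approximatively_compact ::
    "'z set \<Rightarrow> ('z \<Rightarrow> 'z \<Rightarrow> real) \<Rightarrow> 'z topology \<Rightarrow> 'z set \<Rightarrow> bool" where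
  "approximatively_compact Z d T K \<longleftrightarrow>
     K \<subseteq> Z \<and>
     (\<forall>z\<in>Z. \<forall>w. minimizing_sequence d K z w \<longrightarrow>
        (\<exists>g\<in>K. has_subnet_converging_to T w g))"

end

theory Submission
  imports Defs
begin

text \<open>
  Let \<open>g n\<close> be a minimizing sequence for \<open>f\<close>, with values \<open>X n i\<close> on cells \<open>A n i\<close>, \<open>i < k\<close>.
  Along a subsequence, each sequence of values has a weak-star limit \<open>x i\<close> or tends to infinity in
  norm; in the second case the measures of the cells tend to zero so fast that \<open>x i = 0\<close> can
  serve as the limit (\<open>limit_value_subsequence\<close>). In both cases
  distances to fixed points do not increase in the limit.

  Let \<open>m w\<close> be the least of the numbers \<open>norm (f w - x i) powr p\<close>. This is the cost of the best
  step function with values \<open>x i\<close>, so its integral is at least the infimum \<open>D\<close> of the costs.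
  Conversely, lower semicontinuity (\<open>eventually_cost_le\<close>) shows that on sets of finite measure the
  cost of using \<open>x i\<close> on \<open>A n i\<close> is, up to a small error, at most the cost of \<open>g n\<close>. As the latter
  tends to \<open>D\<close>, the integral of \<open>m\<close> equals \<open>D\<close>, and the excess of \<open>norm (f w - x i) powr p\<close> over
  \<open>m w\<close>, integrated over the part of \<open>A n i\<close> in a set of finite measure, tends to zero. So the
  measure of the points in this part where \<open>x i\<close> is not nearest to \<open>f\<close> tends to zero (\<open>misplaced_measure_tendsto_0\<close>).

  It remains to exclude that two values compete for the same points, since the cells could
  then oscillate and the weak limit could take values strictly between \<open>x i\<close> and \<open>x j\<close>. This is where
  differentiability of the norm enters. The values \<open>x i\<close> are optimal, and a set of
  shared nearest points may be given to either of two values. Thus one value is optimal for two cells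
  that differ by this set, and its first-order condition then holds on the set and on its
  measurable subsets, which is possible only if \<open>f = x i\<close> almost everywhere there
  (\<open>shared_nearest_points_null\<close>). Hence the nearest value is almost everywhere
  unique, and \<open>g n\<close> converges to the nearest step function when integrated over sets of finite
  measure (\<open>integral_functional_tendsto\<close>). Boundedness and density of simple functions in the
  predual give weak-star convergence (\<open>pairing_tendsto\<close>).
\<close>

section \<open>Strong measurability and approximation by simple functions\<close>

lemma strongly_measurable_simple: "simple_function M f \<Longrightarrow> strongly_measurable M f"
  unfolding strongly_measurable_def by (rule exI[of _ "\<lambda>_. f"]) auto

lemma strongly_measurable_diff:
  assumes "strongly_measurable M f" "strongly_measurable M g"
  shows "strongly_measurable M (\<lambda>w. f w - g w)"
proof -
  obtain s t where
      s: "\<And>n. simple_function M (s n)" "\<And>w. w \<in> space M \<Longrightarrow> (\<lambda>n::nat. s n w) \<longlonglongrightarrow> f w" and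
      t: "\<And>n. simple_function M (t n)" "\<And>w. w \<in> space M \<Longrightarrow> (\<lambda>n::nat. t n w) \<longlonglongrightarrow> g w"
    using assms unfolding strongly_measurable_def by metis
  show ?thesis
    unfolding strongly_measurable_def
  proof (intro exI[of _ "\<lambda>n w. s n w - t n w"] conjI allI ballI)
    show "simple_function M (\<lambda>w. s n w - t n w)" for n
      using s(1) t(1) by (rule simple_function_compose2[where h="(-)"])
    show "(\<lambda>n. s n w - t n w) \<longlonglongrightarrow> f w - g w" if "w \<in> space M" for w
      using s(2) t(2) that by (intro tendsto_diff)
  qed
qed

lemma strongly_measurable_norm:
  assumes "strongly_measurable M f"
  shows "(\<lambda>w. norm (f w)) \<in> borel_measurable M"
proof -
  obtain s where s: "\<And>n. simple_function M (s n)" "\<And>w. w \<in> space M \<Longrightarrow> (\<lambda>n::nat. s n w) \<longlonglongrightarrow> f w"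
    using assms unfolding strongly_measurable_def by metis
  show ?thesis
  proof (rule borel_measurable_LIMSEQ_real)
    show "(\<lambda>n. norm (s n w)) \<longlonglongrightarrow> norm (f w)" if "w \<in> space M" for w
      using s(2)[OF that] by (rule tendsto_norm)
    show "(\<lambda>w. norm (s n w)) \<in> borel_measurable M" for n
      using s(1) by (intro borel_measurable_simple_function simple_function_compose1[where g=norm])
  qed
qed

lemma strongly_measurable_norm_diff:
  "strongly_measurable M f \<Longrightarrow> strongly_measurable M g \<Longrightarrow>
     (\<lambda>w. norm (f w - g w)) \<in> borel_measurable M"
  by (intro strongly_measurable_norm strongly_measurable_diff)

lemma strongly_measurable_norm_diff_const:
  "strongly_measurable M f \<Longrightarrow> (\<lambda>w. norm (f w - c)) \<in> borel_measurable M"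
  by (rule strongly_measurable_norm_diff) (auto intro: strongly_measurable_simple)

lemma strongly_measurable_pairing:
  fixes \<phi> :: "'a \<Rightarrow> ('y::real_normed_vector \<Rightarrow>\<^sub>L real)"
  assumes "strongly_measurable M \<phi>" "strongly_measurable M h"
  shows "(\<lambda>w. blinfun_apply (\<phi> w) (h w)) \<in> borel_measurable M"
proof -
  obtain s t where
      s: "\<And>n. simple_function M (s n)" "\<And>w. w \<in> space M \<Longrightarrow> (\<lambda>n::nat. s n w) \<longlonglongrightarrow> \<phi> w" and
      t: "\<And>n. simple_function M (t n)" "\<And>w. w \<in> space M \<Longrightarrow> (\<lambda>n::nat. t n w) \<longlonglongrightarrow> h w"
    using assms unfolding strongly_measurable_def by metis
  show ?thesis
  proof (rule borel_measurable_LIMSEQ_real)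
    show "(\<lambda>n. blinfun_apply (s n w) (t n w)) \<longlonglongrightarrow> blinfun_apply (\<phi> w) (h w)"
      if "w \<in> space M" for w
      using s(2)[OF that] t(2)[OF that] by (intro tendsto_intros)
    show "(\<lambda>w. blinfun_apply (s n w) (t n w)) \<in> borel_measurable M" for n
      using s(1) t(1)
      by (intro borel_measurable_simple_function simple_function_compose2[where h=blinfun_apply])
  qed
qed

text \<open>
  Cutting an approximating sequence off where it is more than twice as large as its limit keeps
  it simple and pointwise convergent, and makes it usable with dominated convergence.
\<close>

lemma dominated_simple_sequence:
  assumes f: "strongly_measurable M f"
  obtains s where "\<And>n::nat. simple_function M (s n)"
    and "\<And>w. w \<in> space M \<Longrightarrow> (\<lambda>n. s n w) \<longlonglongrightarrow> f w"
    and "\<And>n w. norm (s n w) \<le> 2 * norm (f w)"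
proof -
  obtain s where s: "\<And>n. simple_function M (s n)" "\<And>w. w \<in> space M \<Longrightarrow> (\<lambda>n::nat. s n w) \<longlonglongrightarrow> f w"
    using f unfolding strongly_measurable_def by metis
  let ?t = "\<lambda>n w. if norm (s n w) \<le> 2 * norm (f w) then s n w else 0"
  show thesis
  proof
    fix n
    have [measurable]: "(\<lambda>w. norm (s n w)) \<in> borel_measurable M" "(\<lambda>w. norm (f w)) \<in> borel_measurable M"
      using f s(1) by (auto intro: strongly_measurable_norm strongly_measurable_simple)
    show "simple_function M (?t n)"
      by (rule simple_function_If) (use s(1) in auto)
  next
    fix w assume w: "w \<in> space M"
    show "(\<lambda>n. ?t n w) \<longlonglongrightarrow> f w"
    proof (cases "f w = 0")
      case True
      have "?t n w = 0" for n using True by auto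
      then show ?thesis using True by simp
    next
      case False
      have "(\<lambda>n. norm (s n w)) \<longlonglongrightarrow> norm (f w)" using s(2)[OF w] by (rule tendsto_norm)
      then have "\<forall>\<^sub>F n in sequentially. norm (s n w) < 2 * norm (f w)"
        by (rule order_tendstoD) (use False in auto)
      then have "\<forall>\<^sub>F n in sequentially. s n w = ?t n w" by eventually_elim auto
      then show ?thesis using s(2)[OF w] by (rule Lim_transform_eventually[rotated])
    qed
  qed auto
qed

text \<open>
  The weight serves two purposes: with \<open>r = 1\<close> it is the derivative of the cost in the
  semicontinuity argument, and with weight one this is density of simple functions in \<open>Lp\<close>.
\<close>

lemma simple_approximation:
  fixes f :: "'a \<Rightarrow> 'b::real_normed_vector"
  assumes f: "strongly_measurable M f" and r: "0 < r" and \<psi>: "\<And>w. 0 \<le> \<psi> w"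
    and [measurable]: "\<psi> \<in> borel_measurable M"
    and int: "integrable M (\<lambda>w. \<psi> w * norm (f w) powr r)" and e: "0 < e"
  obtains s where "simple_function M s" "\<And>w. norm (s w) \<le> 2 * norm (f w)"
    and "integrable M (\<lambda>w. \<psi> w * norm (f w - s w) powr r)"
    and "(\<integral>w. \<psi> w * norm (f w - s w) powr r \<partial>M) < e"
proof -
  obtain s where s: "\<And>n::nat. simple_function M (s n)"
      "\<And>w. w \<in> space M \<Longrightarrow> (\<lambda>n. s n w) \<longlonglongrightarrow> f w"
      "\<And>n w. norm (s n w) \<le> 2 * norm (f w)"
    using dominated_simple_sequence[OF f] by blast
  have [measurable]: "(\<lambda>w. norm (f w - s n w)) \<in> borel_measurable M" for n
    by (rule strongly_measurable_norm_diff[OF f strongly_measurable_simple[OF s(1)]])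
  have bound: "\<psi> w * norm (f w - s n w) powr r \<le> 3 powr r * (\<psi> w * norm (f w) powr r)" for n w
  proof -
    have "norm (f w - s n w) \<le> 3 * norm (f w)"
      using norm_triangle_ineq4[of "f w" "s n w"] s(3)[of n w] by simp
    then have "norm (f w - s n w) powr r \<le> (3 * norm (f w)) powr r"
      using r by (intro powr_mono2) auto
    then show ?thesis
      using mult_left_mono[OF _ \<psi>[of w]] by (fastforce simp: powr_mult mult.left_commute)
  qed
  have lim: "(\<lambda>n. \<integral>w. \<psi> w * norm (f w - s n w) powr r \<partial>M) \<longlonglongrightarrow> (\<integral>w. 0 \<partial>M)"
  proof (rule integral_dominated_convergence)
    show "integrable M (\<lambda>w. 3 powr r * (\<psi> w * norm (f w) powr r))" using int by simp
    show "AE w in M. (\<lambda>n. \<psi> w * norm (f w - s n w) powr r) \<longlonglongrightarrow> 0"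
    proof (rule AE_I2)
      fix w assume "w \<in> space M"
      then have "(\<lambda>n. norm (f w - s n w)) \<longlonglongrightarrow> norm (f w - f w)"
        using s(2) by (intro tendsto_intros) auto
      then have "(\<lambda>n. norm (f w - s n w) powr r) \<longlonglongrightarrow> 0 powr r"
        using r by (intro tendsto_powr2) auto
      then show "(\<lambda>n. \<psi> w * norm (f w - s n w) powr r) \<longlonglongrightarrow> 0"
        by (simp add: tendsto_mult_right_zero)
    qed
  qed (use bound \<psi> in \<open>auto simp: abs_mult\<close>)
  then have "\<forall>\<^sub>F n in sequentially. (\<integral>w. \<psi> w * norm (f w - s n w) powr r \<partial>M) < e"
    by (rule order_tendstoD) (use e in simp)
  then obtain n where n: "(\<integral>w. \<psi> w * norm (f w - s n w) powr r \<partial>M) < e"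
    by (meson eventually_sequentially order_refl)
  have "integrable M (\<lambda>w. \<psi> w * norm (f w - s n w) powr r)"
    by (rule Bochner_Integration.integrable_bound[of _ "\<lambda>w. 3 powr r * (\<psi> w * norm (f w) powr r)"])
       (use int bound \<psi> in \<open>auto simp: abs_mult\<close>)
  with n s show thesis by (intro that[of "s n"]) auto
qed

section \<open>Powers of the norm\<close>

lemma powr_add_le:
  fixes a b p :: real
  assumes "0 \<le> a" "0 \<le> b" "0 \<le> p"
  shows "(a + b) powr p \<le> 2 powr p * (a powr p + b powr p)"
proof -
  have "(a + b) powr p \<le> (2 * max a b) powr p"
    using assms by (intro powr_mono2) auto
  also have "\<dots> = 2 powr p * max a b powr p" using assms by (simp add: powr_mult)
  also have "max a b powr p \<le> a powr p + b powr p" by (simp add: max_def)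
  finally show ?thesis by simp
qed

lemma norm_diff_powr_le:
  fixes u v :: "'b::real_normed_vector"
  assumes "0 \<le> p"
  shows "norm (u - v) powr p \<le> 2 powr p * (norm u powr p + norm v powr p)"
proof -
  have "norm (u - v) powr p \<le> (norm u + norm v) powr p"
    using assms by (intro powr_mono2 norm_triangle_ineq4) auto
  also have "\<dots> \<le> 2 powr p * (norm u powr p + norm v powr p)"
    using assms by (intro powr_add_le) auto
  finally show ?thesis .
qed

text \<open>
  The conjugate exponent of \<open>p\<close> is \<open>p / (p - 1)\<close>, so this is the inequality of Young for \<open>t\<close> and
  \<open>s powr (p - 1)\<close>.
\<close>

lemma powr_above_tangent:
  fixes s t p :: real
  assumes "1 < p" "0 \<le> s" "0 \<le> t"
  shows "s powr p + p * s powr (p - 1) * (t - s) \<le> t powr p"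
proof -
  define q where "q = p / (p - 1)"
  have q: "1 < q" "1 / p + 1 / q = 1" using assms unfolding q_def by (auto simp: field_simps)
  have "t * s powr (p - 1) \<le> t powr p / p + (s powr (p - 1)) powr q / q"
    using assms q by (intro Youngs_inequality) auto
  also have "(s powr (p - 1)) powr q = s powr p" using assms by (simp add: powr_powr q_def)
  finally have "p * (t * s powr (p - 1)) \<le> p * (t powr p / p + s powr p / q)"
    using assms by (intro mult_left_mono) auto
  also have "\<dots> = t powr p + (p - 1) * s powr p"
    using assms unfolding q_def by (simp add: field_simps)
  finally have "p * (t * s powr (p - 1)) \<le> t powr p + (p - 1) * s powr p" .
  moreover have "s powr (p - 1) * s = s powr p"
    using assms by (cases "s = 0") (auto simp: powr_diff)
  ultimately show ?thesis by (simp add: algebra_simps)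
qed

lemma powr_le_one_add_powr:
  fixes a b t :: real
  assumes "0 \<le> t" "0 \<le> a" "a \<le> b"
  shows "t powr a \<le> 1 + t powr b"
proof (cases "t \<le> 1")
  case True
  then have "t powr a \<le> 1" using assms powr_mono2[of a t 1] by simp
  then show ?thesis by (smt (verit) powr_ge_zero)
next
  case False
  then have "t powr a \<le> t powr b" using assms by (intro powr_mono) auto
  then show ?thesis by simp
qed

lemma norm_powr_convex:
  fixes u v :: "'b::real_normed_vector"
  assumes "1 < p" "0 \<le> t" "t \<le> 1"
  shows "norm (u + t *\<^sub>R v) powr p \<le> (1 - t) * norm u powr p + t * norm (u + v) powr p"
proof -
  have "u + t *\<^sub>R v = (1 - t) *\<^sub>R u + t *\<^sub>R (u + v)" by (simp add: algebra_simps)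
  then have le: "norm (u + t *\<^sub>R v) \<le> (1 - t) * norm u + t * norm (u + v)"
    using assms by (metis abs_of_nonneg diff_ge_0_iff_ge norm_scaleR norm_triangle_ineq)
  let ?s = "(1 - t) * norm u + t * norm (u + v)"
  have s0: "0 \<le> ?s" using assms by auto
  have "norm (u + t *\<^sub>R v) powr p \<le> ?s powr p" using le assms by (intro powr_mono2) auto
  also have "?s powr p \<le> (1 - t) * norm u powr p + t * norm (u + v) powr p"
  proof -
    let ?D = "p * ?s powr (p - 1)"
    have "(1 - t) * (?s powr p + ?D * (norm u - ?s)) + t * (?s powr p + ?D * (norm (u + v) - ?s))
        \<le> (1 - t) * norm u powr p + t * norm (u + v) powr p"
      using assms s0 by (intro add_mono mult_left_mono powr_above_tangent) auto
    also have "(1 - t) * (?s powr p + ?D * (norm u - ?s)) + t * (?s powr p + ?D * (norm (u + v) - ?s))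
        = ?s powr p + ?D * ((1 - t) * norm u + t * norm (u + v) - ?s)"
      by (simp add: algebra_simps)
    finally show ?thesis by simp
  qed
  finally show ?thesis .
qed

lemma norm_powr_midpoint:
  fixes u v :: "'b::real_normed_vector"
  assumes "1 < p"
  shows "2 * norm u powr p \<le> norm (u - v) powr p + norm (u + v) powr p"
proof -
  have *: "(u - v) + (1/2) *\<^sub>R (2 *\<^sub>R v) = u" "(u - v) + 2 *\<^sub>R v = u + v"
    by (simp_all add: scaleR_2)
  show ?thesis
    using norm_powr_convex[of p "1/2" "u - v" "2 *\<^sub>R v"] assms unfolding * by simp
qed

section \<open>The nearest of finitely many values\<close>

lemma Lp_iff_integrable:
  assumes "0 < p"
  shows "f \<in> Lp M p \<longleftrightarrow> strongly_measurable M f \<and> integrable M (\<lambda>w. norm (f w) powr p)"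
proof -
  have "integrable M (\<lambda>w. norm (f w) powr p) \<longleftrightarrow> (\<integral>\<^sup>+w. ennreal (norm (f w) powr p) \<partial>M) < \<infinity>"
    if f: "strongly_measurable M f"
  proof -
    have [measurable]: "(\<lambda>w. norm (f w)) \<in> borel_measurable M" by (rule strongly_measurable_norm[OF f])
    show ?thesis unfolding integrable_iff_bounded by simp
  qed
  then show ?thesis unfolding Lp_def by auto
qed

lemma integrable_norm_diff_powr:
  assumes p: "0 < p" and f: "f \<in> Lp M p" and g: "g \<in> Lp M p"
  shows "integrable M (\<lambda>w. norm (f w - g w) powr p)"
proof (rule Bochner_Integration.integrable_bound)
  show "integrable M (\<lambda>w. 2 powr p * (norm (f w) powr p + norm (g w) powr p))"
    using f g p by (auto simp: Lp_iff_integrable)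
  have [measurable]: "(\<lambda>w. norm (f w - g w)) \<in> borel_measurable M"
    using f g p by (intro strongly_measurable_norm_diff) (auto simp: Lp_iff_integrable)
  show "(\<lambda>w. norm (f w - g w) powr p) \<in> borel_measurable M" by measurable
qed (use norm_diff_powr_le[of p] p in auto)

lemma integrable_indicator_norm_diff_powr:
  assumes p: "0 < p" and f: "f \<in> Lp M p" and B: "B \<in> sets M" "emeasure M B < \<infinity>"
  shows "integrable M (\<lambda>w. indicator B w * norm (f w - c) powr p)"
proof (rule Bochner_Integration.integrable_bound)
  show "integrable M (\<lambda>w. 2 powr p * (norm (f w) powr p + indicator B w * norm c powr p))"
    using f p B by (auto simp: Lp_iff_integrable)
  have [measurable]: "(\<lambda>w. norm (f w - c)) \<in> borel_measurable M"
    using f p by (intro strongly_measurable_norm_diff_const) (auto simp: Lp_iff_integrable)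
  show "(\<lambda>w. indicator B w * norm (f w - c) powr p) \<in> borel_measurable M" using B by measurable
qed (use norm_diff_powr_le[of p] p in \<open>auto simp: indicator_def\<close>)

definition nearest_cost ::
    "real \<Rightarrow> nat \<Rightarrow> ('a \<Rightarrow> 'b::real_normed_vector) \<Rightarrow> (nat \<Rightarrow> 'b) \<Rightarrow> 'a \<Rightarrow> real" where
  "nearest_cost p k f z w = Min ((\<lambda>i. norm (f w - z i) powr p) ` {..<k})"

lemma nearest_cost_le: "i < k \<Longrightarrow> nearest_cost p k f z w \<le> norm (f w - z i) powr p"
  unfolding nearest_cost_def by (intro Min_le) auto

lemma nearest_cost_attained:
  assumes "0 < k"
  obtains i where "i < k" "nearest_cost p k f z w = norm (f w - z i) powr p"
proof -
  have "nearest_cost p k f z w \<in> (\<lambda>i. norm (f w - z i) powr p) ` {..<k}"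
    unfolding nearest_cost_def using assms by (intro Min_in) auto
  then show thesis using that by auto
qed

lemma nearest_cost_nonneg: "0 < k \<Longrightarrow> 0 \<le> nearest_cost p k f z w"
  by (metis nearest_cost_attained powr_ge_zero)

lemma nearest_cost_measurable:
  assumes "strongly_measurable M f"
  shows "nearest_cost p k f z \<in> borel_measurable M"
proof -
  have [measurable]: "(\<lambda>w. norm (f w - z i)) \<in> borel_measurable M" for i
    using assms by (rule strongly_measurable_norm_diff_const)
  show ?thesis unfolding nearest_cost_def[abs_def] by measurable
qed

lemma nearest_cost_integrable_bound:
  assumes "strongly_measurable M f" "0 < k" "integrable M \<phi>"
    and "\<And>w. w \<in> space M \<Longrightarrow> nearest_cost p k f z w \<le> \<phi> w"
  shows "integrable M (nearest_cost p k f z)"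
proof (rule Bochner_Integration.integrable_bound[OF assms(3)])
  show "nearest_cost p k f z \<in> borel_measurable M" using assms(1) by (rule nearest_cost_measurable)
  have "norm (nearest_cost p k f z w) \<le> norm (\<phi> w)" if "w \<in> space M" for w
    using nearest_cost_nonneg[OF assms(2), of p f z w] assms(4)[OF that] by simp
  then show "AE w in M. norm (nearest_cost p k f z w) \<le> norm (\<phi> w)" by (rule AE_I2)
qed

text \<open>
  Sending each point to the nearest of the given values, the one of least index when there are
  several, gives the best step function with these values.
\<close>

lemma nearest_step_function:
  assumes p: "0 < p" and k: "0 < k" and f: "f \<in> Lp M p"
    and int: "integrable M (nearest_cost p k f z)"
  obtains g where "g \<in> G_set M p k"
    and "\<And>w. w \<in> space M \<Longrightarrow>
           \<exists>i<k. g w = z i \<and> norm (f w - z i) powr p = nearest_cost p k f z w"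
proof -
  let ?m = "nearest_cost p k f z"
  have fm: "strongly_measurable M f" and fi: "integrable M (\<lambda>w. norm (f w) powr p)"
    using f p by (auto simp: Lp_iff_integrable)
  have [measurable]: "(\<lambda>w. norm (f w - z i)) \<in> borel_measurable M" for i
    using fm by (rule strongly_measurable_norm_diff_const)
  have [measurable]: "?m \<in> borel_measurable M" using fm by (rule nearest_cost_measurable)
  define A where "A i = {w \<in> space M. norm (f w - z i) powr p = ?m w \<and>
                                     (\<forall>j<i. norm (f w - z j) powr p \<noteq> ?m w)}" for i
  define g where "g w = (\<Sum>i<k. indicator (A i) w *\<^sub>R z i)" for w
  have A: "A i \<in> sets M" for i unfolding A_def by measurable
  have disj: "disjoint_family_on A {..<k}"
    unfolding disjoint_family_on_def A_def by (auto simp: nat_neq_iff)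
  have cover: "\<exists>i<k. w \<in> A i" if "w \<in> space M" for w
  proof -
    let ?P = "\<lambda>i. norm (f w - z i) powr p = ?m w"
    obtain i0 where i0: "i0 < k" "?P i0" using nearest_cost_attained[OF k, of p f z w] by metis
    have "?P (LEAST i. ?P i)" using i0(2) by (rule LeastI)
    moreover have "\<not> ?P j" if "j < (LEAST i. ?P i)" for j using that by (rule not_less_Least)
    moreover have "(LEAST i. ?P i) < k" using Least_le[of ?P, OF i0(2)] i0(1) by simp
    ultimately show ?thesis unfolding A_def using that by blast
  qed
  have val: "g w = z i" if "i < k" "w \<in> A i" for i w
  proof -
    have "indicator (A j) w *\<^sub>R z j = (if j = i then z i else 0)" if "j < k" for j
      using disj \<open>i < k\<close> \<open>w \<in> A i\<close> that
      by (auto simp: disjoint_family_on_def indicator_def)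
    then have "g w = (\<Sum>j<k. if j = i then z i else 0)" unfolding g_def by (intro sum.cong) auto
    then show ?thesis using \<open>i < k\<close> by simp
  qed
  have near: "\<exists>i<k. g w = z i \<and> norm (f w - z i) powr p = ?m w" if w: "w \<in> space M" for w
  proof -
    obtain i where i: "i < k" "w \<in> A i" using cover[OF w] by blast
    have "norm (f w - z i) powr p = ?m w" using i(2) by (simp add: A_def)
    then show ?thesis using i val by blast
  qed
  have "simple_function M (\<lambda>w. indicator (A i) w *\<^sub>R z i)" for i
    by (rule simple_function_compose1[where g = "\<lambda>t. t *\<^sub>R z i"]) (use A in auto)
  then have sf: "simple_function M g" unfolding g_def by (intro simple_function_sum)
  have gm: "strongly_measurable M g" using sf by (rule strongly_measurable_simple)
  have [measurable]: "(\<lambda>w. norm (g w)) \<in> borel_measurable M" using gm by (rule strongly_measurable_norm)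
  have "integrable M (\<lambda>w. norm (g w) powr p)"
  proof (rule Bochner_Integration.integrable_bound)
    show "integrable M (\<lambda>w. 2 powr p * (norm (f w) powr p + ?m w))" using fi int by auto
    show "AE w in M. norm (norm (g w) powr p) \<le> norm (2 powr p * (norm (f w) powr p + ?m w))"
    proof (rule AE_I2)
      fix w assume "w \<in> space M"
      from near[OF this] obtain i where "g w = z i" "norm (f w - z i) powr p = ?m w" by blast
      then have "norm (g w) powr p \<le> 2 powr p * (norm (f w) powr p + ?m w)"
        using norm_diff_powr_le[of p "f w" "f w - g w"] p by simp
      then show "norm (norm (g w) powr p) \<le> norm (2 powr p * (norm (f w) powr p + ?m w))"
        by (smt (verit) powr_ge_zero real_norm_def)
    qed
  qed measurable
  then have "g \<in> Lp M p" using gm p by (simp add: Lp_iff_integrable)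
  moreover have "(\<Union>i<k. A i) = space M" using cover by (auto simp: A_def)
  ultimately have "g \<in> G_set M p k"
    unfolding G_set_def using A disj g_def by blast
  then show thesis using near by (rule that)
qed

lemma Lp_dist_nonneg: "0 \<le> Lp_dist M p f g"
  unfolding Lp_dist_def Lp_norm_def by simp

lemma Lp_dist_powr:
  assumes "0 < p"
  shows "Lp_dist M p f g powr p = (\<integral>w. norm (f w - g w) powr p \<partial>M)"
  unfolding Lp_dist_def Lp_norm_def using assms by (simp add: powr_powr)

lemma infimum_le_nearest_cost:
  assumes p: "0 < p" and k: "0 < k" and f: "f \<in> Lp M p"
    and int: "integrable M (nearest_cost p k f z)"
  shows "(INF u\<in>G_set M p k. Lp_dist M p f u) powr p \<le> (\<integral>w. nearest_cost p k f z w \<partial>M)"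
proof -
  obtain g where g: "g \<in> G_set M p k"
      "\<And>w. w \<in> space M \<Longrightarrow> \<exists>i<k. g w = z i \<and> norm (f w - z i) powr p = nearest_cost p k f z w"
    using nearest_step_function[OF assms] by blast
  have "(INF u\<in>G_set M p k. Lp_dist M p f u) \<le> Lp_dist M p f g"
    using g(1) by (intro cINF_lower bdd_belowI2[where m=0] Lp_dist_nonneg)
  moreover have "0 \<le> (INF u\<in>G_set M p k. Lp_dist M p f u)"
    using g(1) by (intro cINF_greatest Lp_dist_nonneg) auto
  ultimately have "(INF u\<in>G_set M p k. Lp_dist M p f u) powr p \<le> Lp_dist M p f g powr p"
    using p by (intro powr_mono2) auto
  also have "\<dots> = (\<integral>w. nearest_cost p k f z w \<partial>M)"
  proof -
    have "norm (f w - g w) powr p = nearest_cost p k f z w" if "w \<in> space M" for w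
      using g(2)[OF that] by auto
    then show ?thesis
      unfolding Lp_dist_powr[OF p] by (intro Bochner_Integration.integral_cong) auto
  qed
  finally show ?thesis .
qed

section \<open>Lower semicontinuity of the cost\<close>

text \<open>
  The sets \<open>A n\<close> may oscillate, so the two integrals are compared for each \<open>n\<close> separately.
  Convexity of \<open>t \<mapsto> t\<^sup>p\<close> bounds the difference of the two costs from below by an integral over \<open>A n\<close> of
  \<open>\<psi> w * (norm (f w - X n) - norm (f w - x))\<close> with a fixed integrable weight \<open>\<psi>\<close>. The bracket is
  Lipschitz in \<open>f w\<close>, uniformly in \<open>n\<close>, so \<open>f\<close> may be replaced there by a simple function, for
  which the hypothesis on \<open>X\<close> is used at finitely many points only.
\<close>

lemma eventually_cost_le:
  fixes f :: "'a \<Rightarrow> 'b::real_normed_vector" and X :: "nat \<Rightarrow> 'b"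
  assumes p: "1 < p" and f: "f \<in> Lp M p"
    and A: "\<And>n. A n \<in> sets M" and B: "B \<in> sets M" "emeasure M B < \<infinity>"
    and lsc: "\<And>c e. 0 < e \<Longrightarrow> \<forall>\<^sub>F n in sequentially. norm (c - x) - e \<le> norm (c - X n)"
    and e: "0 < e"
  shows "\<forall>\<^sub>F n in sequentially.
           (\<integral>w. indicator (A n \<inter> B) w * norm (f w - x) powr p \<partial>M)
             \<le> (\<integral>w. indicator (A n \<inter> B) w * norm (f w - X n) powr p \<partial>M) + e"
proof -
  have p0: "0 < p" using p by simp
  have fm: "strongly_measurable M f" using f p0 by (simp add: Lp_iff_integrable)
  define \<psi> where "\<psi> w = indicator B w * (p * norm (f w - x) powr (p - 1))" for w
  have [measurable]: "(\<lambda>w. norm (f w - c)) \<in> borel_measurable M" for c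
    using fm by (rule strongly_measurable_norm_diff_const)
  have [measurable]: "(\<lambda>w. norm (f w)) \<in> borel_measurable M" using fm by (rule strongly_measurable_norm)
  note [measurable] = B(1) A
  have \<psi>0: "0 \<le> \<psi> w" for w unfolding \<psi>_def using p by simp
  have [measurable]: "\<psi> \<in> borel_measurable M" unfolding \<psi>_def by measurable
  have intc: "integrable M (\<lambda>w. indicator B w * norm (f w - c) powr p)" for c
    using integrable_indicator_norm_diff_powr[OF p0 f B] .
  have int1: "integrable M (\<lambda>w. indicator B w * (1 + norm (f w - x) powr p))"
    using intc[of x] B by (simp add: distrib_left)
  have \<psi>_le: "\<psi> w \<le> p * (indicator B w * (1 + norm (f w - x) powr p))" for w
    using powr_le_one_add_powr[of "norm (f w - x)" "p - 1" p] p
    unfolding \<psi>_def by (auto simp: indicator_def)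
  have int\<psi>: "integrable M \<psi>"
    by (rule Bochner_Integration.integrable_bound
          [of _ "\<lambda>w. p * (indicator B w * (1 + norm (f w - x) powr p))"])
       (use int1 \<psi>0 \<psi>_le in \<open>auto intro!: AE_I2 order_trans[OF \<psi>_le]\<close>)
  have int\<psi>f: "integrable M (\<lambda>w. \<psi> w * norm (f w) powr 1)"
  proof (rule Bochner_Integration.integrable_bound)
    show "integrable M (\<lambda>w. p * (indicator B w * norm (f w - x) powr p) + norm x * \<psi> w)"
      using intc[of x] int\<psi> by simp
    have "\<psi> w * norm (f w) \<le> p * (indicator B w * norm (f w - x) powr p) + norm x * \<psi> w" for w
    proof -
      have "\<psi> w * norm (f w) \<le> \<psi> w * (norm (f w - x) + norm x)"
        using norm_triangle_sub[of "f w" x] \<psi>0 by (intro mult_left_mono) (auto simp: add.commute)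
      moreover have "\<psi> w * norm (f w - x) = p * (indicator B w * norm (f w - x) powr p)"
        unfolding \<psi>_def by (cases "f w = x") (auto simp: powr_diff)
      ultimately show ?thesis by (simp add: distrib_left mult.commute)
    qed
    then show "AE w in M. norm (\<psi> w * norm (f w) powr 1)
                 \<le> norm (p * (indicator B w * norm (f w - x) powr p) + norm x * \<psi> w)"
      using \<psi>0 by (intro AE_I2) (smt (verit) mult_nonneg_nonneg norm_ge_zero powr_one real_norm_def)
  qed measurable
  obtain s where s: "simple_function M s" "integrable M (\<lambda>w. \<psi> w * norm (f w - s w) powr 1)"
      "(\<integral>w. \<psi> w * norm (f w - s w) powr 1 \<partial>M) < e / 4"
    using simple_approximation[OF fm zero_less_one \<psi>0 \<open>\<psi> \<in> borel_measurable M\<close> int\<psi>f, of "e / 4"] e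
    by auto
  define I where "I = (\<integral>w. \<psi> w \<partial>M)"
  have I: "0 \<le> I" unfolding I_def using \<psi>0 by simp
  define \<delta> where "\<delta> = e / (2 * (I + 1))"
  have \<delta>: "0 < \<delta>" "\<delta> * I \<le> e / 2" using e I unfolding \<delta>_def by (auto simp: field_simps)
  have "finite (s ` space M)" using s(1) by (rule simple_functionD)
  \<comment> \<open>The simple function takes finitely many values, so \<open>lsc\<close> holds for all of them at once.\<close>
  then have "\<forall>\<^sub>F n in sequentially. \<forall>c\<in>s ` space M. norm (c - x) - \<delta> \<le> norm (c - X n)"
    using lsc[OF \<delta>(1)] by (intro eventually_ball_finite) auto
  then show ?thesis
  proof eventually_elim
    case (elim n)
    let ?i = "indicator (A n \<inter> B) :: 'a \<Rightarrow> real"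
    have intA: "integrable M (\<lambda>w. ?i w * norm (f w - c) powr p)" for c
      using integrable_real_mult_indicator[OF A[of n] intc[of c]]
      by (simp add: indicator_inter_arith mult_ac)
    have "?i w * norm (f w - x) powr p
        \<le> ?i w * norm (f w - X n) powr p + (\<delta> * \<psi> w + 2 * (\<psi> w * norm (f w - s w) powr 1))"
      if w: "w \<in> space M" for w
    proof (cases "w \<in> A n \<inter> B")
      case True
      let ?t = "norm (f w - X n)" and ?s = "norm (f w - x)"
      have \<psi>w: "\<psi> w = p * ?s powr (p - 1)" using True by (simp add: \<psi>_def)
      have "norm (s w - X n) \<le> ?t + norm (f w - s w)" "?s \<le> norm (f w - s w) + norm (s w - x)"
        by norm+
      moreover have "norm (s w - x) - \<delta> \<le> norm (s w - X n)" using elim w by blast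
      ultimately have "?s - ?t \<le> \<delta> + 2 * norm (f w - s w)" by linarith
      then have "\<psi> w * (?s - ?t) \<le> \<psi> w * (\<delta> + 2 * norm (f w - s w))"
        by (intro mult_left_mono \<psi>0)
      moreover have "?s powr p + \<psi> w * (?t - ?s) \<le> ?t powr p"
        unfolding \<psi>w using p by (intro powr_above_tangent) auto
      ultimately show ?thesis using True by (simp add: algebra_simps)
    qed (use \<delta>(1) \<psi>0 in auto)
    then have "(\<integral>w. ?i w * norm (f w - x) powr p \<partial>M)
        \<le> (\<integral>w. ?i w * norm (f w - X n) powr p
                + (\<delta> * \<psi> w + 2 * (\<psi> w * norm (f w - s w) powr 1)) \<partial>M)"
      using intA int\<psi> s(2) by (intro integral_mono) auto
    also have "\<dots> = (\<integral>w. ?i w * norm (f w - X n) powr p \<partial>M)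
        + (\<delta> * I + 2 * (\<integral>w. \<psi> w * norm (f w - s w) powr 1 \<partial>M))"
      unfolding I_def using intA int\<psi> s(2) by simp
    finally show ?case using \<delta>(2) s(3) by linarith
  qed
qed

section \<open>Optimal values share no nearest points\<close>

text \<open>
  Along every line the \<open>p\<close>-th power of the norm is differentiable: by the chain rule away from
  zero, and at zero because \<open>p > 1\<close>. The two one-sided difference quotients therefore have the
  same limit and cancel.
\<close>

lemma gateaux_second_difference_tendsto_0:
  fixes u v :: "'b::real_normed_vector"
  assumes p: "1 < p" and G: "gateaux_differentiable_norm TYPE('b)"
  shows "(\<lambda>n. real (Suc n) * (norm (u - inverse (real (Suc n)) *\<^sub>R v) powr p
           + norm (u + inverse (real (Suc n)) *\<^sub>R v) powr p - 2 * norm u powr p)) \<longlonglongrightarrow> 0"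
proof -
  have "\<exists>D. ((\<lambda>t. norm (u + t *\<^sub>R v) powr p) has_real_derivative D) (at 0)"
  proof (cases "u = 0")
    case True
    have "((\<lambda>t::real. norm (u + t *\<^sub>R v) powr p) has_real_derivative 0) (at 0)"
      unfolding has_field_derivative_iff
    proof (rule tendsto_0_le)
      have "((\<lambda>t::real. \<bar>t\<bar> powr (p - 1)) \<longlongrightarrow> 0 powr (p - 1)) (at 0)"
        using p by (intro tendsto_powr2 tendsto_rabs_zero tendsto_ident_at) auto
      then show "((\<lambda>t::real. \<bar>t\<bar> powr (p - 1)) \<longlongrightarrow> 0) (at 0)" by simp
      show "\<forall>\<^sub>F t in at 0. norm ((norm (u + t *\<^sub>R v) powr p - norm (u + 0 *\<^sub>R v) powr p) / (t - 0))
              \<le> norm (\<bar>t\<bar> powr (p - 1)) * norm v powr p"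
        unfolding True eventually_at_filter
        by (intro always_eventually) (auto simp: powr_mult powr_diff)
    qed
    then show ?thesis by blast
  next
    case False
    then obtain D where "((\<lambda>t::real. (norm (u + t *\<^sub>R v) - norm u) / t) \<longlongrightarrow> D v) (at 0)"
      using G unfolding gateaux_differentiable_norm_def gateaux_differentiable_at_def by blast
    then have D: "((\<lambda>t. norm (u + t *\<^sub>R v)) has_real_derivative D v) (at 0)"
      by (simp add: has_field_derivative_iff)
    have "((\<lambda>s. s powr p) has_real_derivative p * norm (u + 0 *\<^sub>R v) powr (p - 1))
            (at (norm (u + 0 *\<^sub>R v)))"
      using False by (intro has_real_derivative_powr) auto
    from DERIV_chain2[OF this D] show ?thesis by blast
  qed
  then obtain D where D: "((\<lambda>t. norm (u + t *\<^sub>R v) powr p) has_real_derivative D) (at 0)"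
    by blast
  let ?q = "\<lambda>t. (norm (u + t *\<^sub>R v) powr p - norm u powr p) / t"
  have q: "(?q \<longlongrightarrow> D) (at 0)" using D by (simp add: has_field_derivative_iff)
  have inv: "(\<lambda>n. inverse (real (Suc n))) \<longlonglongrightarrow> 0" by (rule LIMSEQ_inverse_real_of_nat)
  have "filterlim (\<lambda>n. inverse (real (Suc n))) (at 0) sequentially"
    using inv by (auto simp: filterlim_at simp del: of_nat_Suc)
  from filterlim_compose[OF q this] have 1: "(\<lambda>n. ?q (inverse (real (Suc n)))) \<longlonglongrightarrow> D" .
  have "filterlim (\<lambda>n. - inverse (real (Suc n))) (at 0) sequentially"
    using tendsto_minus[OF inv] by (auto simp: filterlim_at simp del: of_nat_Suc)
  from filterlim_compose[OF q this] have 2: "(\<lambda>n. ?q (- inverse (real (Suc n)))) \<longlonglongrightarrow> D" .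
  have "(\<lambda>n. ?q (inverse (real (Suc n))) - ?q (- inverse (real (Suc n)))) \<longlonglongrightarrow> D - D"
    using 1 2 by (rule tendsto_diff)
  moreover have "?q (inverse (real (Suc n))) - ?q (- inverse (real (Suc n)))
      = real (Suc n) * (norm (u - inverse (real (Suc n)) *\<^sub>R v) powr p
           + norm (u + inverse (real (Suc n)) *\<^sub>R v) powr p - 2 * norm u powr p)" for n
    by (simp add: field_simps del: of_nat_Suc)
  ultimately show ?thesis by simp
qed

text \<open>
  When \<open>x i\<close> is replaced by \<open>y\<close>, the points outside \<open>A\<close> keep a nearest value and the points of
  \<open>A\<close> may use \<open>y\<close>. So a smaller integral for \<open>y\<close> would contradict optimality.
\<close>

lemma optimal_value_on_cell:
  assumes p: "0 < p" and f: "f \<in> Lp M p"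
    and m: "integrable M (nearest_cost p k f x)"
    and opt: "\<And>z. integrable M (nearest_cost p k f z) \<Longrightarrow>
                (\<integral>w. nearest_cost p k f x w \<partial>M) \<le> (\<integral>w. nearest_cost p k f z w \<partial>M)"
    and i: "i < k" and A: "A \<in> sets M" "emeasure M A < \<infinity>"
    and near: "\<And>w. w \<in> A \<Longrightarrow> norm (f w - x i) powr p = nearest_cost p k f x w"
    and other: "\<And>w. w \<in> space M \<Longrightarrow> w \<notin> A \<Longrightarrow>
                  \<exists>l<k. l \<noteq> i \<and> norm (f w - x l) powr p = nearest_cost p k f x w"
  shows "(\<integral>w. indicator A w * norm (f w - x i) powr p \<partial>M)
           \<le> (\<integral>w. indicator A w * norm (f w - y) powr p \<partial>M)"
proof -
  let ?z = "x(i := y)"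
  let ?\<phi> = "\<lambda>w. indicator A w * norm (f w - y) powr p
                + (nearest_cost p k f x w - indicator A w * norm (f w - x i) powr p)"
  have intA: "integrable M (\<lambda>w. indicator A w * norm (f w - c) powr p)" for c
    using p f A by (rule integrable_indicator_norm_diff_powr)
  have int\<phi>: "integrable M ?\<phi>" using intA m by simp
  have le: "nearest_cost p k f ?z w \<le> ?\<phi> w" if w: "w \<in> space M" for w
  proof (cases "w \<in> A")
    case True
    then show ?thesis using nearest_cost_le[OF i, of p f ?z w] near[OF True] by simp
  next
    case False
    obtain l where l: "l < k" "l \<noteq> i" "norm (f w - x l) powr p = nearest_cost p k f x w"
      using other[OF w False] by blast
    then show ?thesis using nearest_cost_le[OF l(1), of p f ?z w] False by simp
  qed
  have intz: "integrable M (nearest_cost p k f ?z)"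
    using f p i int\<phi> le by (intro nearest_cost_integrable_bound[of M f k ?\<phi>]) (auto simp: Lp_iff_integrable)
  have "(\<integral>w. nearest_cost p k f x w \<partial>M) \<le> (\<integral>w. nearest_cost p k f ?z w \<partial>M)"
    using intz by (rule opt)
  also have "\<dots> \<le> (\<integral>w. ?\<phi> w \<partial>M)" using intz int\<phi> le by (intro integral_mono) auto
  also have "\<dots> = (\<integral>w. indicator A w * norm (f w - y) powr p \<partial>M)
      + ((\<integral>w. nearest_cost p k f x w \<partial>M) - (\<integral>w. indicator A w * norm (f w - x i) powr p \<partial>M))"
    using intA m by simp
  finally show ?thesis by simp
qed

text \<open>
  Let \<open>E\<close> be a set of points nearest to both \<open>x i\<close> and \<open>x j\<close> on which moving \<open>x i\<close> by \<open>c\<close> would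
  help. The cell of \<open>x i\<close> may be taken with or without \<open>E\<close>, and \<open>x i\<close> is optimal for both cells.
  Moving it by \<open>c / n\<close> for the larger cell and by \<open>- c / n\<close> for the smaller one, the first-order
  changes outside \<open>E\<close> cancel because the norm is differentiable, whereas on \<open>E\<close> the cost
  decreases at a rate bounded away from zero. So \<open>E\<close> is null. Countably many \<open>c\<close> serve
  all points where \<open>f\<close> differs from \<open>x i\<close>, because the range of \<open>f\<close> is separable.
\<close>

lemma shared_nearest_points_null:
  fixes f :: "'a \<Rightarrow> 'b::real_normed_vector"
  assumes p: "1 < p" and G: "gateaux_differentiable_norm TYPE('b)" and f: "f \<in> Lp M p"
    and m: "integrable M (nearest_cost p k f x)"
    and opt: "\<And>z. integrable M (nearest_cost p k f z) \<Longrightarrow>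
                (\<integral>w. nearest_cost p k f x w \<partial>M) \<le> (\<integral>w. nearest_cost p k f z w \<partial>M)"
    and ij: "i < k" "j < k" "x i \<noteq> x j" and xi: "x i \<noteq> 0"
  shows "AE w in M. \<not> (norm (f w - x i) powr p = nearest_cost p k f x w \<and>
                        norm (f w - x j) powr p = nearest_cost p k f x w)"
proof -
  let ?m = "nearest_cost p k f x"
  have p0: "0 < p" using p by simp
  have fm: "strongly_measurable M f" and fi: "integrable M (\<lambda>w. norm (f w) powr p)"
    using f p0 by (auto simp: Lp_iff_integrable)
  have [measurable]: "(\<lambda>w. norm (f w - c)) \<in> borel_measurable M" for c
    using fm by (rule strongly_measurable_norm_diff_const)
  have [measurable]: "?m \<in> borel_measurable M" using fm by (rule nearest_cost_measurable)
  define T where "T i = {w \<in> space M. norm (f w - x i) powr p = ?m w}" for i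
  have T [measurable]: "T i \<in> sets M" for i unfolding T_def by measurable
  \<comment> \<open>On \<open>T i\<close> the nonzero constant \<open>x i\<close> is the difference of \<open>f\<close> and a function whose \<open>p\<close>-th
    power is integrable. So \<open>T i\<close> has finite measure, and \<open>x i\<close> can be moved within \<open>Lp\<close>.\<close>
  have "integrable M (\<lambda>w. indicator (T i) w * norm (x i) powr p)"
  proof (rule Bochner_Integration.integrable_bound)
    show "integrable M (\<lambda>w. 2 powr p * (norm (f w) powr p + ?m w))" using fi m by auto
    show "AE w in M. norm (indicator (T i) w * norm (x i) powr p)
                       \<le> norm (2 powr p * (norm (f w) powr p + ?m w))"
    proof (rule AE_I2)
      fix w
      have "0 \<le> ?m w" using ij(1) by (intro nearest_cost_nonneg) auto
      moreover have "norm (x i) powr p \<le> 2 powr p * (norm (f w) powr p + ?m w)" if "w \<in> T i"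
        using norm_diff_powr_le[of p "f w" "f w - x i"] that p by (simp add: T_def)
      ultimately show "norm (indicator (T i) w * norm (x i) powr p)
                         \<le> norm (2 powr p * (norm (f w) powr p + ?m w))"
        by (auto simp: indicator_def)
    qed
  qed measurable
  then have "integrable M (\<lambda>w. (indicator (T i) w * norm (x i) powr p) / norm (x i) powr p)"
    by (rule integrable_divide)
  then have "integrable M (indicator (T i) :: 'a \<Rightarrow> real)" using xi by simp
  then have Tfin: "emeasure M (T i) < \<infinity>"
    using T[of i] by (simp add: integrable_indicator_iff)
  have null: "{w \<in> T i \<inter> T j. norm (f w - x i - c) < norm (f w - x i)} \<in> null_sets M"
    (is "?E \<in> _") for c
  proof -
    have diffc: "(\<lambda>w. norm (f w - x i - c)) = (\<lambda>w. norm (f w - (x i + c)))"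
      by (simp add: algebra_simps)
    have [measurable]: "(\<lambda>w. norm (f w - x i - c)) \<in> borel_measurable M" unfolding diffc by measurable
    have E [measurable]: "?E \<in> sets M"
    proof -
      have "?E = (T i \<inter> T j) \<inter> {w \<in> space M. norm (f w - x i - c) < norm (f w - x i)}"
        by (auto simp: T_def)
      also have "\<dots> \<in> sets M" by measurable
      finally show ?thesis .
    qed
    have fin: "emeasure M S < \<infinity>" if "S \<subseteq> T i" for S
      using emeasure_mono[OF that T[of i]] Tfin by (simp add: order_le_less_trans)
    have int: "integrable M (\<lambda>w. indicator S w * norm (f w - d) powr p)"
      if "S \<in> sets M" "S \<subseteq> T i" for S d
      using p0 f that fin by (intro integrable_indicator_norm_diff_powr) auto
    have cell: "(\<integral>w. indicator S w * norm (f w - x i) powr p \<partial>M)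
                  \<le> (\<integral>w. indicator S w * norm (f w - y) powr p \<partial>M)"
      if S: "S \<in> sets M" "S \<subseteq> T i" "T i - T j \<subseteq> S" for S y
    proof (rule optimal_value_on_cell[OF p0 f m opt ij(1) S(1) fin[OF S(2)]])
      show "norm (f w - x i) powr p = ?m w" if "w \<in> S" for w
        using that S(2) by (auto simp: T_def)
      show "\<exists>l<k. l \<noteq> i \<and> norm (f w - x l) powr p = ?m w" if w: "w \<in> space M" "w \<notin> S" for w
      proof (cases "w \<in> T i")
        case True
        then have "w \<in> T j" using w S(3) by blast
        then show ?thesis using ij by (auto simp: T_def)
      next
        case False
        obtain l where "l < k" "?m w = norm (f w - x l) powr p"
          using nearest_cost_attained[of k p f x w] ij(1) by auto
        then show ?thesis using False w by (auto simp: T_def)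
      qed
    qed
    \<comment> \<open>\<open>\<kappa>\<close> is the gain on the contested set when \<open>x i\<close> moves all the way to \<open>x i + c\<close>. By
      convexity, moving by \<open>c / Suc n\<close> gains at least \<open>\<kappa> / Suc n\<close>. The rescaled loss \<open>\<rho> n\<close> on the rest of
      the cell is a second difference.\<close>
    define \<kappa> where "\<kappa> w = indicator ?E w * norm (f w - x i) powr p
                              - indicator ?E w * norm (f w - (x i + c)) powr p" for w
    define \<rho> where "\<rho> n w = indicator (T i - ?E) w * (real (Suc n) *
        (norm (f w - x i - inverse (real (Suc n)) *\<^sub>R c) powr p
         + norm (f w - x i + inverse (real (Suc n)) *\<^sub>R c) powr p - 2 * norm (f w - x i) powr p))"
      for n w
    have \<rho>_alt: "\<rho> n w = real (Suc n) *
        (indicator (T i - ?E) w * norm (f w - (x i + inverse (real (Suc n)) *\<^sub>R c)) powr p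
         + indicator (T i - ?E) w * norm (f w - (x i - inverse (real (Suc n)) *\<^sub>R c)) powr p
         - 2 * (indicator (T i - ?E) w * norm (f w - x i) powr p))" for n w
      unfolding \<rho>_def by (simp add: algebra_simps del: of_nat_Suc)
    have D: "T i - ?E \<in> sets M" by measurable
    have int\<kappa>: "integrable M \<kappa>" unfolding \<kappa>_def using int[OF E] by auto
    have int\<rho>: "integrable M (\<rho> n)" for n
      unfolding \<rho>_alt[abs_def]
      using int[OF D] by (intro integrable_mult_right integrable_diff integrable_add) auto
    have \<kappa>_pos: "0 < \<kappa> w" if "w \<in> ?E" for w
      using that powr_less_mono2[of p "norm (f w - x i - c)" "norm (f w - x i)"] p
      by (simp add: \<kappa>_def diff_diff_eq)
    have \<kappa>_nonneg: "0 \<le> \<kappa> w" for w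
      using \<kappa>_pos[of w] by (cases "w \<in> ?E") (auto simp: \<kappa>_def simp del: mem_Collect_eq)
    have \<rho>_nonneg: "0 \<le> \<rho> n w" for n w
      using norm_powr_midpoint[OF p, of "f w - x i" "inverse (real (Suc n)) *\<^sub>R c"]
      unfolding \<rho>_def by (intro mult_nonneg_nonneg) auto
    have step: "real (Suc n) * norm (u + inverse (real (Suc n)) *\<^sub>R v) powr p
        \<le> (real (Suc n) - 1) * norm u powr p + norm (u + v) powr p" for n and u v :: 'b
    proof -
      have "real (Suc n) * norm (u + inverse (real (Suc n)) *\<^sub>R v) powr p
          \<le> real (Suc n) * ((1 - inverse (real (Suc n))) * norm u powr p
                                + inverse (real (Suc n)) * norm (u + v) powr p)"
        using p by (intro mult_left_mono norm_powr_convex) (auto simp: field_simps)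
      also have "\<dots> = (real (Suc n) - 1) * norm u powr p + norm (u + v) powr p"
        by (simp add: distrib_left right_diff_distrib flip: mult.assoc del: of_nat_Suc)
      finally show ?thesis .
    qed
    have \<rho>_0: "\<rho> 0 w = indicator (T i - ?E) w * (norm (f w - x i - c) powr p
                + norm (f w - x i + c) powr p - 2 * norm (f w - x i) powr p)" for w
      unfolding \<rho>_def by simp
    have \<rho>_le: "\<rho> n w \<le> \<rho> 0 w" for n w
      using step[of n "f w - x i" c] step[of n "f w - x i" "- c"]
      unfolding \<rho>_0 unfolding \<rho>_def by (auto simp: indicator_def algebra_simps simp del: of_nat_Suc)
    have "(\<lambda>n. \<integral>w. \<rho> n w \<partial>M) \<longlonglongrightarrow> (\<integral>w. 0 \<partial>M)"
    proof (rule integral_dominated_convergence[OF _ _ int\<rho>[of 0]])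
      show "AE w in M. (\<lambda>n. \<rho> n w) \<longlonglongrightarrow> 0"
        unfolding \<rho>_def by (intro AE_I2 tendsto_mult_right_zero gateaux_second_difference_tendsto_0 p G)
      show "AE w in M. norm (\<rho> n w) \<le> \<rho> 0 w" for n using \<rho>_nonneg \<rho>_le by auto
    qed (use int\<rho> in auto)
    moreover have "(\<integral>w. \<kappa> w \<partial>M) \<le> (\<integral>w. \<rho> n w \<partial>M)" for n
    proof -
      let ?h = "inverse (real (Suc n)) *\<^sub>R c"
      let ?I = "\<lambda>S d. \<integral>w. indicator S w * norm (f w - d) powr p \<partial>M"
      have split: "?I (T i) d = ?I (T i - ?E) d + ?I ?E d" for d
      proof -
        have "?I (T i) d = (\<integral>w. indicator (T i - ?E) w * norm (f w - d) powr p
                                 + indicator ?E w * norm (f w - d) powr p \<partial>M)"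
          by (intro Bochner_Integration.integral_cong) (auto simp: indicator_def)
        then show ?thesis using int[OF D] int[OF E] by simp
      qed
      have 1: "?I (T i - ?E) (x i) + ?I ?E (x i) \<le> ?I (T i - ?E) (x i + ?h) + ?I ?E (x i + ?h)"
        using cell[of "T i" "x i + ?h"] by (simp add: split)
      have 2: "?I (T i - ?E) (x i) \<le> ?I (T i - ?E) (x i - ?h)"
        by (rule cell[OF D]) auto
      have "real (Suc n) * ?I ?E (x i + ?h) \<le> (real (Suc n) - 1) * ?I ?E (x i) + ?I ?E (x i + c)"
      proof -
        have "real (Suc n) * ?I ?E (x i + ?h)
            = (\<integral>w. real (Suc n) * (indicator ?E w * norm (f w - (x i + ?h)) powr p) \<partial>M)" by simp
        also have "\<dots> \<le> (\<integral>w. (real (Suc n) - 1) * (indicator ?E w * norm (f w - x i) powr p)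
                             + indicator ?E w * norm (f w - (x i + c)) powr p \<partial>M)"
        proof (rule integral_mono)
          fix w
          show "real (Suc n) * (indicator ?E w * norm (f w - (x i + ?h)) powr p)
              \<le> (real (Suc n) - 1) * (indicator ?E w * norm (f w - x i) powr p)
                 + indicator ?E w * norm (f w - (x i + c)) powr p"
            using step[of n "f w - x i" "- c"]
            by (auto simp: indicator_def diff_diff_eq simp del: of_nat_Suc)
        qed (use int[OF E] in \<open>auto simp del: of_nat_Suc\<close>)
        also have "\<dots> = (real (Suc n) - 1) * ?I ?E (x i) + ?I ?E (x i + c)"
          using int[OF E] by (simp del: of_nat_Suc)
        finally show ?thesis .
      qed
      moreover have "0 \<le> real (Suc n) * (?I (T i - ?E) (x i + ?h) + ?I (T i - ?E) (x i - ?h)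
                      - 2 * ?I (T i - ?E) (x i) + ?I ?E (x i + ?h) - ?I ?E (x i))"
        using 1 2 by (intro mult_nonneg_nonneg) auto
      moreover have "(\<integral>w. \<rho> n w \<partial>M) = real (Suc n) * (?I (T i - ?E) (x i + ?h)
                       + ?I (T i - ?E) (x i - ?h) - 2 * ?I (T i - ?E) (x i))"
        unfolding \<rho>_alt using int[OF D] by (simp del: of_nat_Suc)
      moreover have "(\<integral>w. \<kappa> w \<partial>M) = ?I ?E (x i) - ?I ?E (x i + c)"
        unfolding \<kappa>_def using int[OF E] by simp
      ultimately show ?thesis by (simp add: algebra_simps del: of_nat_Suc)
    qed
    ultimately have "(\<integral>w. \<kappa> w \<partial>M) \<le> 0"
      by (intro LIMSEQ_le_const) auto
    then have "(\<integral>w. \<kappa> w \<partial>M) = 0" using \<kappa>_nonneg by (simp add: antisym)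
    then have "AE w in M. \<kappa> w = 0"
      using integral_nonneg_eq_0_iff_AE[OF int\<kappa>] \<kappa>_nonneg by auto
    then have "AE w in M. w \<notin> ?E"
    proof (rule eventually_mono)
      show "w \<notin> ?E" if "\<kappa> w = 0" for w
      proof
        assume "w \<in> ?E"
        then have "0 < \<kappa> w" by (rule \<kappa>_pos)
        then show False using that by simp
      qed
    qed
    then show ?thesis using E by (simp add: AE_iff_null_sets)
  qed
  obtain s where s: "\<And>n::nat. simple_function M (s n)" "\<And>w. w \<in> space M \<Longrightarrow> (\<lambda>n. s n w) \<longlonglongrightarrow> f w"
    using fm unfolding strongly_measurable_def by metis
  define C where "C = (\<Union>n. (\<lambda>w. s n w - x i) ` space M)"
  have "countable C"
    unfolding C_def
  proof (rule countable_UN[OF countableI_type], rule countable_finite)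
    fix n
    have "finite ((\<lambda>c. c - x i) ` s n ` space M)" using simple_functionD(1)[OF s(1)] by blast
    then show "finite ((\<lambda>w. s n w - x i) ` space M)" by (simp add: image_image)
  qed
  then have null_UN: "(\<Union>c\<in>C. {w \<in> T i \<inter> T j. norm (f w - x i - c) < norm (f w - x i)}) \<in> null_sets M"
    using null by (intro null_sets_UN')
  have "w \<in> (\<Union>c\<in>C. {w \<in> T i \<inter> T j. norm (f w - x i - c) < norm (f w - x i)})"
    if w: "w \<in> T i \<inter> T j" for w
  proof -
    have "f w \<noteq> x i"
    proof
      assume "f w = x i"
      then have "norm (f w - x j) powr p = 0" using w by (simp add: T_def)
      then show False using \<open>f w = x i\<close> ij(3) by simp
    qed
    then have "0 < norm (f w - x i)" by simp
    moreover have "w \<in> space M" using w by (simp add: T_def)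
    ultimately have "\<forall>\<^sub>F n in sequentially. dist (s n w) (f w) < norm (f w - x i)"
      using s(2) by (intro tendstoD) auto
    then obtain n where "dist (s n w) (f w) < norm (f w - x i)"
      by (meson eventually_sequentially order_refl)
    then have "norm (f w - x i - (s n w - x i)) < norm (f w - x i)"
      by (simp add: dist_norm norm_minus_commute)
    moreover have "s n w - x i \<in> C" unfolding C_def using \<open>w \<in> space M\<close> by blast
    ultimately show ?thesis using w by blast
  qed
  then show ?thesis
    by (intro AE_I'[OF null_UN]) (auto simp: T_def)
qed

text \<open>Of two different values at least one is nonzero, and that one can be moved.\<close>

lemma nearest_value_unique_AE:
  fixes f :: "'a \<Rightarrow> 'b::real_normed_vector"
  assumes p: "1 < p" and G: "gateaux_differentiable_norm TYPE('b)" and f: "f \<in> Lp M p"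
    and m: "integrable M (nearest_cost p k f x)"
    and opt: "\<And>z. integrable M (nearest_cost p k f z) \<Longrightarrow>
                (\<integral>w. nearest_cost p k f x w \<partial>M) \<le> (\<integral>w. nearest_cost p k f z w \<partial>M)"
  shows "AE w in M. \<forall>i<k. \<forall>j<k. norm (f w - x i) powr p = nearest_cost p k f x w \<longrightarrow>
           norm (f w - x j) powr p = nearest_cost p k f x w \<longrightarrow> x i = x j"
proof -
  have "AE w in M. norm (f w - x i) powr p = nearest_cost p k f x w \<longrightarrow>
           norm (f w - x j) powr p = nearest_cost p k f x w \<longrightarrow> x i = x j"
    if ij: "i < k" "j < k" for i j
  proof (cases "x i = x j")
    case False
    then consider "x i \<noteq> 0" | "x j \<noteq> 0" by metis
    then show ?thesis
    proof cases
      case 1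
      then show ?thesis
        using shared_nearest_points_null[OF p G f m opt ij(1) ij(2) False] by auto
    next
      case 2
      then show ?thesis
        using shared_nearest_points_null[OF p G f m opt ij(2) ij(1) False[symmetric]] by auto
    qed
  qed auto
  then have "AE w in M. \<forall>i\<in>{..<k}. \<forall>j\<in>{..<k}. norm (f w - x i) powr p = nearest_cost p k f x w \<longrightarrow>
           norm (f w - x j) powr p = nearest_cost p k f x w \<longrightarrow> x i = x j"
    by (intro AE_finite_allI) auto
  then show ?thesis by (rule eventually_mono) auto
qed

section \<open>Minimizing sequences of step functions\<close>

lemma cell_measure_bound:
  assumes p: "0 < p" and g: "g \<in> Lp M p" and A: "A \<in> sets M"
    and val: "\<And>w. w \<in> A \<Longrightarrow> g w = c" and c: "c \<noteq> 0"
  shows "emeasure M A < \<infinity>" and "norm c powr p * measure M A \<le> (\<integral>w. norm (g w) powr p \<partial>M)"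
proof -
  have gi: "integrable M (\<lambda>w. norm (g w) powr p)" using g p by (simp add: Lp_iff_integrable)
  have le: "indicator A w * norm c powr p \<le> norm (g w) powr p" for w
    using val[of w] by (auto simp: indicator_def)
  have int: "integrable M (\<lambda>w. indicator A w * norm c powr p)"
    by (rule Bochner_Integration.integrable_bound[OF gi]) (use A le in auto)
  then have "integrable M (\<lambda>w. (indicator A w * norm c powr p) / norm c powr p)"
    by (rule integrable_divide)
  then have "integrable M (indicator A :: 'a \<Rightarrow> real)" using c by simp
  then show "emeasure M A < \<infinity>" using A by (simp add: integrable_indicator_iff)
  have "(\<integral>w. indicator A w * norm c powr p \<partial>M) \<le> (\<integral>w. norm (g w) powr p \<partial>M)"
    using int gi le by (intro integral_mono) auto
  then show "norm c powr p * measure M A \<le> (\<integral>w. norm (g w) powr p \<partial>M)"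
    using A by (simp add: mult.commute)
qed

text \<open>
  The superlevel sets of \<open>m\<close> have finite measure by the inequality of Markov, and they
  exhaust the set where \<open>m\<close> is positive.
\<close>

lemma integral_concentrated_on_finite_measure:
  fixes m :: "'a \<Rightarrow> real"
  assumes m: "integrable M m" and nonneg: "\<And>w. 0 \<le> m w" and e: "0 < e"
  obtains B where "B \<in> sets M" "emeasure M B < \<infinity>"
    and "(\<integral>w. m w \<partial>M) - (\<integral>w. indicator B w * m w \<partial>M) < e"
proof -
  define S where "S n = {w \<in> space M. inverse (real (Suc n)) \<le> m w}" for n
  have [measurable]: "m \<in> borel_measurable M" using m by auto
  have S [measurable]: "S n \<in> sets M" for n unfolding S_def by measurable
  have fin: "emeasure M (S n) < \<infinity>" for n
  proof -
    have "emeasure M (S n) \<le> (1 / inverse (real (Suc n))) * (\<integral>w. m w \<partial>M)"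
      unfolding S_def using m nonneg by (intro integral_Markov_inequality) auto
    then show ?thesis by (rule order_le_less_trans) simp
  qed
  have "(\<lambda>n. \<integral>w. indicator (S n) w * m w \<partial>M) \<longlonglongrightarrow> (\<integral>w. m w \<partial>M)"
  proof (rule integral_dominated_convergence[OF _ _ m])
    show "AE w in M. (\<lambda>n. indicator (S n) w * m w) \<longlonglongrightarrow> m w"
    proof (rule AE_I2)
      fix w assume w: "w \<in> space M"
      show "(\<lambda>n. indicator (S n) w * m w) \<longlonglongrightarrow> m w"
      proof (cases "m w = 0")
        case False
        then have "0 < m w" using nonneg[of w] by simp
        then have "\<forall>\<^sub>F n in sequentially. inverse (real (Suc n)) < m w"
          using LIMSEQ_inverse_real_of_nat by (rule order_tendstoD(2)[rotated])
        then have "\<forall>\<^sub>F n in sequentially. indicator (S n) w * m w = m w"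
          by eventually_elim (use w in \<open>auto simp: S_def\<close>)
        then show ?thesis by (rule tendsto_eventually)
      qed simp
    qed
  qed (use nonneg in \<open>auto simp: indicator_def\<close>)
  then have "\<forall>\<^sub>F n in sequentially. (\<integral>w. m w \<partial>M) - e < (\<integral>w. indicator (S n) w * m w \<partial>M)"
    by (rule order_tendstoD) (use e in simp)
  then obtain n where "(\<integral>w. m w \<partial>M) - e < (\<integral>w. indicator (S n) w * m w \<partial>M)"
    by (meson eventually_sequentially order_refl)
  with S fin show thesis by (intro that[of "S n"]) auto
qed

text \<open>
  The step functions \<open>g n\<close> minimize the distance to \<open>f\<close>; \<open>D\<close> is the \<open>p\<close>-th power of the infimum.
  The values \<open>X n i\<close> are assumed to converge to \<open>x i\<close> only in the sense that distances do not
  increase in the limit. This holds for weak-star limits, and it also holds with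
  an arbitrary \<open>x i\<close> if \<open>norm (X n i)\<close> tends to infinity.
\<close>

locale minimizing_step_functions =
  fixes M :: "'a measure" and p :: real and k :: nat and f :: "'a \<Rightarrow> 'b::real_normed_vector"
    and A :: "nat \<Rightarrow> nat \<Rightarrow> 'a set" and X :: "nat \<Rightarrow> nat \<Rightarrow> 'b" and x :: "nat \<Rightarrow> 'b"
    and g :: "nat \<Rightarrow> 'a \<Rightarrow> 'b" and D :: real
  assumes p: "1 < p" and k: "0 < k" and f: "f \<in> Lp M p"
    and g: "\<And>n. g n \<in> Lp M p"
    and A: "\<And>n i. i < k \<Longrightarrow> A n i \<in> sets M"
    and disj: "\<And>n. disjoint_family_on (A n) {..<k}"
    and cover: "\<And>n. (\<Union>i<k. A n i) = space M"
    and val: "\<And>n i w. i < k \<Longrightarrow> w \<in> A n i \<Longrightarrow> g n w = X n i"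
    and lsc: "\<And>i c e. i < k \<Longrightarrow> 0 < e \<Longrightarrow>
                \<forall>\<^sub>F n in sequentially. norm (c - x i) - e \<le> norm (c - X n i)"
    and cost: "(\<lambda>n. \<integral>w. norm (f w - g n w) powr p \<partial>M) \<longlonglongrightarrow> D"
    and opt: "\<And>z. integrable M (nearest_cost p k f z) \<Longrightarrow> D \<le> (\<integral>w. nearest_cost p k f z w \<partial>M)"
begin

abbreviation m :: "'a \<Rightarrow> real" where "m \<equiv> nearest_cost p k f x"

lemma p0: "0 < p" using p by simp

lemma f_measurable: "strongly_measurable M f"
  using f p0 by (simp add: Lp_iff_integrable)

lemma norm_f_diff_measurable [measurable]: "(\<lambda>w. norm (f w - c)) \<in> borel_measurable M"
  using f_measurable by (rule strongly_measurable_norm_diff_const)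

lemma m_measurable [measurable]: "m \<in> borel_measurable M"
  using f_measurable by (rule nearest_cost_measurable)

lemma m_nonneg: "0 \<le> m w" using k by (rule nearest_cost_nonneg)

lemma sum_cells:
  fixes \<phi> :: "nat \<Rightarrow> real"
  assumes "i < k" "w \<in> A n i"
  shows "(\<Sum>j<k. indicator (A n j) w * \<phi> j) = \<phi> i"
proof -
  have "indicator (A n j) w * \<phi> j = (if j = i then \<phi> i else 0)" if "j < k" for j
    using disj[of n] assms that by (auto simp: disjoint_family_on_def indicator_def)
  then have "(\<Sum>j<k. indicator (A n j) w * \<phi> j) = (\<Sum>j<k. if j = i then \<phi> i else 0)"
    by (intro sum.cong) auto
  then show ?thesis using assms by simp
qed

lemma cell_exists:
  assumes "w \<in> space M"
  obtains i where "i < k" "w \<in> A n i"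
  using assms cover[of n] by blast

text \<open>
  A step function of finite norm on a space of infinite measure has to take the value zero, and
  a value that vanishes infinitely often has limit zero by semicontinuity. This makes
  \<open>m\<close> integrable, because then \<open>m w \<le> norm (f w) powr p\<close>.
\<close>

lemma zero_is_limit_value:
  assumes inf: "emeasure M (space M) = \<infinity>"
  shows "\<exists>i<k. x i = 0"
proof (rule ccontr)
  assume "\<not> ?thesis"
  then have nz: "x i \<noteq> 0" if "i < k" for i using that by blast
  have "\<forall>\<^sub>F n in sequentially. \<forall>i\<in>{..<k}. X n i \<noteq> 0"
  proof (intro eventually_ball_finite ballI)
    fix i assume "i \<in> {..<k}"
    then have "\<forall>\<^sub>F n in sequentially. norm (0 - x i) - norm (x i) / 2 \<le> norm (0 - X n i)"
      using nz by (intro lsc) auto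
    then show "\<forall>\<^sub>F n in sequentially. X n i \<noteq> 0"
      by eventually_elim (use nz \<open>i \<in> {..<k}\<close> in auto)
  qed simp
  then obtain n where n: "\<And>i. i < k \<Longrightarrow> X n i \<noteq> 0"
    by (metis (mono_tags, lifting) eventually_sequentially lessThan_iff order_refl)
  have "emeasure M (A n i) < \<infinity>" if "i < k" for i
    using cell_measure_bound(1)[OF p0 g A[OF that] val[OF that] n[OF that]] .
  then have "(\<Sum>i<k. emeasure M (A n i)) < \<infinity>" by simp
  moreover have "emeasure M (\<Union>i<k. A n i) \<le> (\<Sum>i<k. emeasure M (A n i))"
    using A by (intro emeasure_subadditive_finite) auto
  ultimately have "emeasure M (space M) < \<infinity>" unfolding cover by (rule order_le_less_trans[rotated])
  then show False using inf by simp
qed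

lemma integrable_m: "integrable M m"
proof (cases "emeasure M (space M) = \<infinity>")
  case True
  then obtain i where i: "i < k" "x i = 0" using zero_is_limit_value by blast
  show ?thesis
    by (rule nearest_cost_integrable_bound[of M f k "\<lambda>w. norm (f w) powr p"])
       (use f p0 k i nearest_cost_le[OF i(1), of p f x] in \<open>auto simp: Lp_iff_integrable\<close>)
next
  case False
  then have "integrable M (\<lambda>w. indicator (space M) w * norm (f w - x 0) powr p)"
    by (intro integrable_indicator_norm_diff_powr[OF p0 f]) (auto simp: less_top)
  then show ?thesis
    by (rule nearest_cost_integrable_bound[OF f_measurable k]) (use nearest_cost_le[OF k] in auto)
qed

lemma integrable_m_on: "B \<in> sets M \<Longrightarrow> integrable M (\<lambda>w. indicator B w * m w)"
  using integrable_m by (rule integrable_real_mult_indicator[where f = m, simplified mult.commute, rotated])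

lemma integrable_cost_on:
  assumes "B \<in> sets M" "emeasure M B < \<infinity>" "i < k"
  shows "integrable M (\<lambda>w. indicator (A n i \<inter> B) w * norm (f w - c) powr p)"
proof (rule integrable_indicator_norm_diff_powr[OF p0 f])
  show "A n i \<inter> B \<in> sets M" using A assms by auto
  have "emeasure M (A n i \<inter> B) \<le> emeasure M B" using assms by (intro emeasure_mono) auto
  then show "emeasure M (A n i \<inter> B) < \<infinity>" using assms(2) by (rule order_le_less_trans)
qed

text \<open>
  The restriction to \<open>B\<close> is there because a nonzero constant \<open>x i\<close> has a finite cost only on
  sets of finite measure.
\<close>

definition excess :: "nat \<Rightarrow> 'a set \<Rightarrow> nat \<Rightarrow> real" where
  "excess n B i = (\<integral>w. indicator (A n i \<inter> B) w * (norm (f w - x i) powr p - m w) \<partial>M)"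

lemma integrable_excess:
  assumes "B \<in> sets M" "emeasure M B < \<infinity>" "i < k"
  shows "integrable M (\<lambda>w. indicator (A n i \<inter> B) w * (norm (f w - x i) powr p - m w))"
proof -
  have "integrable M (\<lambda>w. indicator (A n i \<inter> B) w * norm (f w - x i) powr p
                          - indicator (A n i \<inter> B) w * m w)"
    using integrable_cost_on[OF assms] integrable_m_on A[OF assms(3)] assms(1) by auto
  then show ?thesis by (simp add: right_diff_distrib)
qed

lemma excess_nonneg: "i < k \<Longrightarrow> 0 \<le> excess n B i"
  unfolding excess_def using nearest_cost_le[of i k p f x] by (intro Bochner_Integration.integral_nonneg) auto

lemma sum_excess_le:
  assumes B: "B \<in> sets M" "emeasure M B < \<infinity>" and e: "0 < e"
  shows "\<forall>\<^sub>F n in sequentially. (\<Sum>i<k. excess n B i) \<le> D - (\<integral>w. indicator B w * m w \<partial>M) + e"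
proof -
  have "\<forall>\<^sub>F n in sequentially. \<forall>i\<in>{..<k}.
           (\<integral>w. indicator (A n i \<inter> B) w * norm (f w - x i) powr p \<partial>M)
             \<le> (\<integral>w. indicator (A n i \<inter> B) w * norm (f w - X n i) powr p \<partial>M) + e / (2 * k)"
    using A B lsc e k
    by (intro eventually_ball_finite ballI eventually_cost_le[OF p f]) auto
  moreover have "\<forall>\<^sub>F n in sequentially. (\<integral>w. norm (f w - g n w) powr p \<partial>M) < D + e / 2"
    using cost by (rule order_tendstoD) (use e in simp)
  ultimately show ?thesis
  proof eventually_elim
    case (elim n)
    note int = integrable_cost_on[OF B]
    have [measurable]: "A n i \<inter> B \<in> sets M" if "i < k" for i using A that B by auto
    have sum_eq: "(\<Sum>i<k. \<integral>w. indicator (A n i \<inter> B) w * \<phi> i w \<partial>M) = (\<integral>w. indicator B w * \<phi>' w \<partial>M)"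
      if i: "\<And>i. i < k \<Longrightarrow> integrable M (\<lambda>w. indicator (A n i \<inter> B) w * \<phi> i w)"
        and eq: "\<And>i w. i < k \<Longrightarrow> w \<in> A n i \<Longrightarrow> \<phi> i w = \<phi>' w" for \<phi> :: "nat \<Rightarrow> 'a \<Rightarrow> real" and \<phi>'
    proof -
      have "(\<Sum>i<k. \<integral>w. indicator (A n i \<inter> B) w * \<phi> i w \<partial>M)
          = (\<integral>w. (\<Sum>i<k. indicator (A n i \<inter> B) w * \<phi> i w) \<partial>M)"
        using i by (intro Bochner_Integration.integral_sum[symmetric]) auto
      also have "\<dots> = (\<integral>w. indicator B w * \<phi>' w \<partial>M)"
      proof (rule Bochner_Integration.integral_cong)
        fix w assume "w \<in> space M"
        then obtain i where i: "i < k" "w \<in> A n i" by (rule cell_exists)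
        have "(\<Sum>i<k. indicator (A n i \<inter> B) w * \<phi> i w)
            = (\<Sum>i<k. indicator (A n i) w * (indicator B w * \<phi> i w))"
          by (simp add: indicator_inter_arith mult.assoc)
        also have "\<dots> = indicator B w * \<phi> i w" by (rule sum_cells[OF i])
        finally show "(\<Sum>i<k. indicator (A n i \<inter> B) w * \<phi> i w) = indicator B w * \<phi>' w"
          using eq[OF i] by simp
      qed simp
      finally show ?thesis .
    qed
    have "(\<Sum>i<k. excess n B i)
        = (\<Sum>i<k. (\<integral>w. indicator (A n i \<inter> B) w * norm (f w - x i) powr p \<partial>M)
                   - (\<integral>w. indicator (A n i \<inter> B) w * m w \<partial>M))"
      unfolding excess_def right_diff_distrib
      using int integrable_m_on A B by (intro sum.cong Bochner_Integration.integral_diff) auto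
    also have "\<dots> = (\<Sum>i<k. \<integral>w. indicator (A n i \<inter> B) w * norm (f w - x i) powr p \<partial>M)
                   - (\<integral>w. indicator B w * m w \<partial>M)"
      unfolding sum_subtractf using sum_eq[of "\<lambda>_. m" m] integrable_m_on A B by simp
    also have "(\<Sum>i<k. \<integral>w. indicator (A n i \<inter> B) w * norm (f w - x i) powr p \<partial>M)
        \<le> (\<Sum>i<k. (\<integral>w. indicator (A n i \<inter> B) w * norm (f w - X n i) powr p \<partial>M) + e / (2 * k))"
      using elim(1) by (intro sum_mono) auto
    also have "\<dots> = (\<integral>w. indicator B w * norm (f w - g n w) powr p \<partial>M) + e / 2"
      unfolding sum.distrib using k val int
      by (subst sum_eq[where \<phi>' = "\<lambda>w. norm (f w - g n w) powr p"]) auto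
    also have "(\<integral>w. indicator B w * norm (f w - g n w) powr p \<partial>M) \<le> (\<integral>w. norm (f w - g n w) powr p \<partial>M)"
      using integrable_norm_diff_powr[OF p0 f g, of n] B
        integrable_real_mult_indicator[OF B(1) integrable_norm_diff_powr[OF p0 f g, of n]]
      by (intro integral_mono) (auto simp: mult.commute indicator_def)
    finally show ?case using elim(2) by simp
  qed
qed

lemma integral_m: "(\<integral>w. m w \<partial>M) = D"
proof (rule antisym)
  show "D \<le> (\<integral>w. m w \<partial>M)" using integrable_m by (rule opt)
  show "(\<integral>w. m w \<partial>M) \<le> D"
  proof (rule field_le_epsilon)
    fix e :: real assume e: "0 < e"
    obtain B where B: "B \<in> sets M" "emeasure M B < \<infinity>"
        "(\<integral>w. m w \<partial>M) - (\<integral>w. indicator B w * m w \<partial>M) < e / 2"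
      using integral_concentrated_on_finite_measure[OF integrable_m m_nonneg, of "e / 2"] e by auto
    have "\<forall>\<^sub>F n in sequentially. (\<Sum>i<k. excess n B i) \<le> D - (\<integral>w. indicator B w * m w \<partial>M) + e / 2"
      using B e by (intro sum_excess_le) auto
    then obtain n where "(\<Sum>i<k. excess n B i) \<le> D - (\<integral>w. indicator B w * m w \<partial>M) + e / 2"
      by (meson eventually_sequentially order_refl)
    moreover have "0 \<le> (\<Sum>i<k. excess n B i)" by (intro sum_nonneg excess_nonneg) auto
    ultimately show "(\<integral>w. m w \<partial>M) \<le> D + e" using B(3) by linarith
  qed
qed

text \<open>
  On sets of finite measure, the estimate of the total excess has the error
  \<open>D - (\<integral>w. indicator B w * m w \<partial>M)\<close>. It becomes small when \<open>B\<close> is enlarged, and the excess on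
  the original set is no larger.
\<close>

lemma excess_tendsto_0:
  assumes B: "B \<in> sets M" "emeasure M B < \<infinity>" and i: "i < k"
  shows "(\<lambda>n. excess n B i) \<longlonglongrightarrow> 0"
proof (rule order_tendstoI)
  fix e :: real assume e: "0 < e"
  obtain B0 where B0: "B0 \<in> sets M" "emeasure M B0 < \<infinity>"
      "(\<integral>w. m w \<partial>M) - (\<integral>w. indicator B0 w * m w \<partial>M) < e / 2"
    using integral_concentrated_on_finite_measure[OF integrable_m m_nonneg, of "e / 2"] e by auto
  let ?B = "B \<union> B0"
  have fin: "?B \<in> sets M" "emeasure M ?B < \<infinity>"
    using B B0 emeasure_subadditive[of B M B0]
    by (auto intro: order_le_less_trans simp: ennreal_add_eq_top less_top)
  have "(\<integral>w. indicator B0 w * m w \<partial>M) \<le> (\<integral>w. indicator ?B w * m w \<partial>M)"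
    using B0 fin m_nonneg by (intro integral_mono integrable_m_on) (auto simp: indicator_def)
  then have small: "D - (\<integral>w. indicator ?B w * m w \<partial>M) < e / 2" using B0(3) integral_m by simp
  have "\<forall>\<^sub>F n in sequentially. (\<Sum>i<k. excess n ?B i) \<le> D - (\<integral>w. indicator ?B w * m w \<partial>M) + e / 2"
    using fin e by (intro sum_excess_le) auto
  then show "\<forall>\<^sub>F n in sequentially. excess n B i < e"
  proof eventually_elim
    case (elim n)
    have "excess n B i \<le> excess n ?B i"
      unfolding excess_def
      using integrable_excess[OF B i] integrable_excess[OF fin i] nearest_cost_le[OF i, of p f x]
      by (intro integral_mono) (auto simp: indicator_def)
    also have "\<dots> \<le> (\<Sum>i<k. excess n ?B i)"
      using i excess_nonneg by (intro member_le_sum) auto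
    finally show ?case using elim small by linarith
  qed
next
  fix e :: real assume "e < 0"
  then show "\<forall>\<^sub>F n in sequentially. e < excess n B i"
    using excess_nonneg[OF i] by (intro always_eventually) (auto intro: less_le_trans)
qed

text \<open>
  By the inequality of Markov, a small excess bounds the measure of the points where \<open>x i\<close>
  is farther than the nearest value by a definite amount. The points of \<open>B\<close> where it is farther by
  less form a set independent of \<open>n\<close>, whose measure is small by continuity from above.
\<close>

lemma misplaced_measure_tendsto_0:
  assumes B: "B \<in> sets M" "emeasure M B < \<infinity>" and i: "i < k"
  shows "(\<lambda>n. measure M (A n i \<inter> B \<inter> {w \<in> space M. norm (f w - x i) powr p \<noteq> m w})) \<longlonglongrightarrow> 0"
    (is "(\<lambda>n. measure M (?P n)) \<longlonglongrightarrow> 0")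
proof (rule order_tendstoI)
  let ?\<phi> = "\<lambda>w. norm (f w - x i) powr p - m w"
  have \<phi>0: "0 \<le> ?\<phi> w" for w using nearest_cost_le[OF i, of p f x] by simp
  fix e :: real assume e: "0 < e"
  note [measurable] = B(1) A[OF i]
  define S where "S N = B \<inter> {w \<in> space M. 0 < ?\<phi> w \<and> ?\<phi> w < inverse (real (Suc N))}" for N
  have S [measurable]: "S N \<in> sets M" for N unfolding S_def by measurable
  have fin: "emeasure M C < \<infinity>" if "C \<subseteq> B" for C
    using emeasure_mono[OF that B(1)] B(2) by (rule order_le_less_trans)
  have "(\<lambda>N. measure M (S N)) \<longlonglongrightarrow> measure M (\<Inter>N. S N)"
  proof (rule Lim_measure_decseq)
    show "decseq S"
    proof (rule decseq_SucI)
      show "S (Suc N) \<subseteq> S N" for N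
        unfolding S_def
        by (auto elim!: less_le_trans simp: field_simps)
    qed
    show "emeasure M (S N) \<noteq> \<infinity>" for N using fin[of "S N"] by (auto simp: S_def)
  qed (use S in auto)
  moreover have "(\<Inter>N. S N) = {}"
  proof (rule equals0I)
    fix w assume w: "w \<in> (\<Inter>N. S N)"
    then have "0 < ?\<phi> w" by (auto simp: S_def)
    then obtain N where "inverse (real (Suc N)) < ?\<phi> w" using reals_Archimedean by blast
    moreover have "w \<in> S N" using w by blast
    ultimately show False by (simp add: S_def)
  qed
  ultimately have "(\<lambda>N. measure M (S N)) \<longlonglongrightarrow> 0" by simp
  then have "\<forall>\<^sub>F N in sequentially. measure M (S N) < e / 2"
    by (rule order_tendstoD) (use e in simp)
  then obtain N where N: "measure M (S N) < e / 2"
    by (meson eventually_sequentially order_refl)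
  have "\<forall>\<^sub>F n in sequentially. excess n B i < e / (2 * real (Suc N))"
    using excess_tendsto_0[OF B i] by (rule order_tendstoD) (use e in \<open>auto simp del: of_nat_Suc\<close>)
  then show "\<forall>\<^sub>F n in sequentially. measure M (?P n) < e"
  proof eventually_elim
    case (elim n)
    have P [measurable]: "?P n \<in> sets M" by measurable
    have "measure M (?P n) = (\<integral>w. indicator (?P n) w \<partial>M)" using P by simp
    also have "\<dots> \<le> (\<integral>w. indicator (S N) w + real (Suc N) * (indicator (A n i \<inter> B) w * ?\<phi> w) \<partial>M)"
    proof (rule integral_mono)
      show "integrable M (indicator (?P n) :: 'a \<Rightarrow> real)"
        using P fin[of "?P n"] by (auto simp: integrable_indicator_iff)
      show "integrable M (\<lambda>w. indicator (S N) w + real (Suc N) * (indicator (A n i \<inter> B) w * ?\<phi> w))"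
        using S fin[of "S N"] integrable_excess[OF B i]
        by (intro Bochner_Integration.integrable_add integrable_mult_right)
           (auto simp: integrable_indicator_iff S_def)
      fix w
      have "1 \<le> real (Suc N) * ?\<phi> w" if "w \<in> ?P n" "w \<notin> S N"
      proof -
        have "inverse (real (Suc N)) \<le> ?\<phi> w" using that \<phi>0[of w] by (auto simp: S_def)
        then show ?thesis by (simp add: field_simps del: of_nat_Suc)
      qed
      moreover have "0 \<le> real (Suc N) * (indicator (A n i \<inter> B) w * ?\<phi> w)" using \<phi>0 by simp
      ultimately show "indicator (?P n) w
          \<le> indicator (S N) w + real (Suc N) * (indicator (A n i \<inter> B) w * ?\<phi> w)"
        by (auto simp: indicator_def simp del: of_nat_Suc)
    qed
    also have "\<dots> = measure M (S N) + real (Suc N) * excess n B i"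
      unfolding excess_def using S fin[of "S N"] integrable_excess[OF B i]
      by (subst Bochner_Integration.integral_add)
         (auto simp: integrable_indicator_iff S_def simp del: of_nat_Suc)
    also have "real (Suc N) * excess n B i < e / 2"
      using elim by (simp add: field_simps del: of_nat_Suc)
    finally show ?case using N by simp
  qed
next
  fix e :: real assume "e < 0"
  then show "\<forall>\<^sub>F n in sequentially. e < measure M (?P n)"
    by (intro always_eventually) (auto intro: less_le_trans)
qed

text \<open>
  Outside the misplaced points of \<open>A n i\<close> the value \<open>u w\<close> is \<open>x i\<close> for almost all \<open>w\<close>, because the
  nearest value is unique. So replacing \<open>L (u w)\<close> by \<open>L (x i)\<close> on \<open>A n i\<close> costs little, and
  passing from there to \<open>L (X n i)\<close> is the hypothesis on \<open>L\<close>.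
\<close>

lemma integral_functional_tendsto:
  fixes L :: "'b \<Rightarrow> real"
  assumes G: "gateaux_differentiable_norm TYPE('b)"
    and B: "B \<in> sets M" "emeasure M B < \<infinity>"
    and L: "\<And>i. i < k \<Longrightarrow> (\<lambda>n. (L (X n i) - L (x i)) * measure M (A n i \<inter> B)) \<longlonglongrightarrow> 0"
    and u: "\<And>w. w \<in> space M \<Longrightarrow> \<exists>i<k. u w = x i \<and> norm (f w - x i) powr p = m w"
    and [measurable]: "(\<lambda>w. L (u w)) \<in> borel_measurable M"
  shows "(\<lambda>n. \<integral>w. indicator B w * L (g n w) \<partial>M) \<longlonglongrightarrow> (\<integral>w. indicator B w * L (u w) \<partial>M)"
proof -
  define C where "C = (\<Sum>j<k. \<bar>L (x j)\<bar>)"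
  have Lx: "\<bar>L (x i)\<bar> \<le> C" if "i < k" for i
    unfolding C_def using that by (intro member_le_sum) auto
  have Lu: "\<bar>L (u w)\<bar> \<le> C" if "w \<in> space M" for w using u[OF that] Lx by auto
  have C0: "0 \<le> C" unfolding C_def by (intro sum_nonneg) auto
  let ?N = "\<lambda>i. {w \<in> space M. norm (f w - x i) powr p \<noteq> m w}"
  have AB: "A n i \<inter> B \<in> sets M" "emeasure M (A n i \<inter> B) < \<infinity>" if "i < k" for n i
    using A[OF that] B emeasure_mono[of "A n i \<inter> B" B M] by (auto intro: order_le_less_trans)
  have intu: "integrable M (\<lambda>w. indicator S w * L (u w))"
    if S: "S \<in> sets M" "emeasure M S < \<infinity>" for S
  proof (rule Bochner_Integration.integrable_bound)
    show "integrable M (\<lambda>w. C * indicator S w)" using S by (simp add: integrable_indicator_iff)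
    show "(\<lambda>w. indicator S w * L (u w)) \<in> borel_measurable M" using S by measurable
    show "AE w in M. norm (indicator S w * L (u w)) \<le> norm (C * indicator S w)"
      using Lu C0 by (intro AE_I2) (auto simp: indicator_def)
  qed
  have AE_unique: "AE w in M. \<forall>i<k. \<forall>j<k. norm (f w - x i) powr p = m w \<longrightarrow>
                     norm (f w - x j) powr p = m w \<longrightarrow> x i = x j"
    by (rule nearest_value_unique_AE[OF p G f integrable_m]) (simp add: integral_m opt)
  have diff: "(\<integral>w. indicator B w * L (g n w) \<partial>M) - (\<integral>w. indicator B w * L (u w) \<partial>M)
      = (\<Sum>i<k. (L (X n i) - L (x i)) * measure M (A n i \<inter> B)
               + (\<integral>w. indicator (A n i \<inter> B) w * (L (x i) - L (u w)) \<partial>M))" for n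
  proof -
    have split: "indicator B w * \<phi> w = (\<Sum>i<k. indicator (A n i \<inter> B) w * \<phi> w)"
      if "w \<in> space M" for w and \<phi> :: "'a \<Rightarrow> real"
    proof -
      obtain i where i: "i < k" "w \<in> A n i" using \<open>w \<in> space M\<close> by (rule cell_exists)
      show ?thesis using sum_cells[OF i, of "\<lambda>_. indicator B w * \<phi> w"]
        by (simp add: indicator_inter_arith mult.assoc)
    qed
    have ind: "integrable M (\<lambda>w. indicator (A n i \<inter> B) w * c)" if "i < k" for i and c :: real
      using AB[OF that] by (simp add: integrable_indicator_iff)
    have gX: "indicator (A n i \<inter> B) w * L (g n w) = indicator (A n i \<inter> B) w * L (X n i)"
      if "i < k" for i w using val[OF that] by (auto simp: indicator_def)
    have split_g: "indicator B w * L (g n w) = (\<Sum>i<k. indicator (A n i \<inter> B) w * L (X n i))"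
      if "w \<in> space M" for w
      unfolding split[OF that, of "\<lambda>w. L (g n w)"] by (intro sum.cong gX) auto
    have "(\<integral>w. indicator B w * L (g n w) \<partial>M) - (\<integral>w. indicator B w * L (u w) \<partial>M)
        = (\<integral>w. (\<Sum>i<k. indicator (A n i \<inter> B) w * L (X n i)) \<partial>M)
          - (\<integral>w. (\<Sum>i<k. indicator (A n i \<inter> B) w * L (u w)) \<partial>M)"
      using split_g split[of _ "\<lambda>w. L (u w)"]
      by (intro arg_cong2[where f = "(-)"] Bochner_Integration.integral_cong refl)
    also have "\<dots> = (\<Sum>i<k. (\<integral>w. indicator (A n i \<inter> B) w * L (X n i) \<partial>M)
                            - (\<integral>w. indicator (A n i \<inter> B) w * L (u w) \<partial>M))"
      unfolding sum_subtractf using ind intu AB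
      by (intro arg_cong2[where f = "(-)"] Bochner_Integration.integral_sum) auto
    also have "\<dots> = (\<Sum>i<k. (L (X n i) - L (x i)) * measure M (A n i \<inter> B)
               + (\<integral>w. indicator (A n i \<inter> B) w * (L (x i) - L (u w)) \<partial>M))"
    proof (rule sum.cong)
      fix i assume "i \<in> {..<k}"
      then have i: "i < k" by simp
      have "(\<integral>w. indicator (A n i \<inter> B) w * (L (x i) - L (u w)) \<partial>M)
          = L (x i) * measure M (A n i \<inter> B) - (\<integral>w. indicator (A n i \<inter> B) w * L (u w) \<partial>M)"
        unfolding right_diff_distrib using ind[OF i] intu AB[OF i]
        by (subst Bochner_Integration.integral_diff) (auto simp: mult.commute[of "L (x i)"])
      moreover have "(\<integral>w. indicator (A n i \<inter> B) w * L (X n i) \<partial>M) = L (X n i) * measure M (A n i \<inter> B)"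
        using AB[OF i] by simp
      ultimately show "(\<integral>w. indicator (A n i \<inter> B) w * L (X n i) \<partial>M)
            - (\<integral>w. indicator (A n i \<inter> B) w * L (u w) \<partial>M)
          = (L (X n i) - L (x i)) * measure M (A n i \<inter> B)
            + (\<integral>w. indicator (A n i \<inter> B) w * (L (x i) - L (u w)) \<partial>M)"
        by (simp add: algebra_simps)
    qed simp
    finally show ?thesis .
  qed
  have lim: "(\<lambda>n. \<integral>w. indicator (A n i \<inter> B) w * (L (x i) - L (u w)) \<partial>M) \<longlonglongrightarrow> 0" if i: "i < k" for i
  proof (rule tendsto_0_le)
    show "(\<lambda>n. measure M (A n i \<inter> B \<inter> ?N i)) \<longlonglongrightarrow> 0" using B i by (rule misplaced_measure_tendsto_0)
    have "norm (\<integral>w. indicator (A n i \<inter> B) w * (L (x i) - L (u w)) \<partial>M)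
        \<le> norm (measure M (A n i \<inter> B \<inter> ?N i)) * (2 * C)" for n
    proof -
      have P: "A n i \<inter> B \<inter> ?N i \<in> sets M" using AB(1)[OF i] by measurable
      have "emeasure M (A n i \<inter> B \<inter> ?N i) < \<infinity>"
        using emeasure_mono[OF _ AB(1)[OF i], of "A n i \<inter> B \<inter> ?N i"] AB(2)[OF i]
        by (auto intro: order_le_less_trans)
      then have intP: "integrable M (\<lambda>w. 2 * C * indicator (A n i \<inter> B \<inter> ?N i) w)"
        using P by (simp add: integrable_indicator_iff)
      have int: "integrable M (\<lambda>w. indicator (A n i \<inter> B) w * (L (x i) - L (u w)))"
        unfolding right_diff_distrib using AB[OF i] intu by (auto simp: integrable_indicator_iff)
      have "norm (\<integral>w. indicator (A n i \<inter> B) w * (L (x i) - L (u w)) \<partial>M)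
          \<le> (\<integral>w. norm (indicator (A n i \<inter> B) w * (L (x i) - L (u w))) \<partial>M)"
        by (rule integral_norm_bound)
      also have "\<dots> \<le> (\<integral>w. 2 * C * indicator (A n i \<inter> B \<inter> ?N i) w \<partial>M)"
      proof (rule integral_mono_AE)
        show "integrable M (\<lambda>w. norm (indicator (A n i \<inter> B) w * (L (x i) - L (u w))))"
          using int by (rule integrable_norm)
        show "AE w in M. norm (indicator (A n i \<inter> B) w * (L (x i) - L (u w)))
                \<le> 2 * C * indicator (A n i \<inter> B \<inter> ?N i) w"
          using AE_unique
        proof (rule AE_mp, intro AE_I2 impI)
          fix w assume w: "w \<in> space M" and
            uniq: "\<forall>i<k. \<forall>j<k. norm (f w - x i) powr p = m w \<longrightarrow>
                     norm (f w - x j) powr p = m w \<longrightarrow> x i = x j"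
          show "norm (indicator (A n i \<inter> B) w * (L (x i) - L (u w)))
                \<le> 2 * C * indicator (A n i \<inter> B \<inter> ?N i) w"
          proof (cases "w \<in> ?N i")
            case True
            then show ?thesis using Lx[OF i] Lu[OF w] by (auto simp: indicator_def)
          next
            case False
            then have "u w = x i" using u[OF w] uniq i w by force
            then show ?thesis using C0 by simp
          qed
        qed
      qed (rule intP)
      finally show ?thesis using P C0 by (simp add: mult.commute)
    qed
    then show "\<forall>\<^sub>F n in sequentially. norm (\<integral>w. indicator (A n i \<inter> B) w * (L (x i) - L (u w)) \<partial>M)
        \<le> norm (measure M (A n i \<inter> B \<inter> ?N i)) * (2 * C)" by (intro always_eventually) auto
  qed
  have "(\<lambda>n. \<Sum>i<k. (L (X n i) - L (x i)) * measure M (A n i \<inter> B)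
               + (\<integral>w. indicator (A n i \<inter> B) w * (L (x i) - L (u w)) \<partial>M)) \<longlonglongrightarrow> (\<Sum>i<k. 0 + 0)"
    using L lim by (intro tendsto_sum tendsto_add) auto
  then show ?thesis unfolding diff[symmetric] by (simp add: Lim_null[of "\<lambda>n. \<integral>w. indicator B w * L (g n w) \<partial>M"])
qed

end

section \<open>Weak-star convergence\<close>

lemma limitin_weak_star_apply:
  assumes "limitin weak_star \<phi> \<psi> F"
  shows "((\<lambda>n. blinfun_apply (\<phi> n) y) \<longlongrightarrow> blinfun_apply \<psi> y) F"
  using continuous_map_limit[OF strong_operator_topology_continuous_evaluation assms, of y]
  by (simp add: o_def)

lemma weak_star_norm_diff_lsc:
  fixes \<phi> :: "nat \<Rightarrow> ('y::real_normed_vector \<Rightarrow>\<^sub>L real)"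
  assumes lim: "\<And>y. (\<lambda>n. blinfun_apply (\<phi> n) y) \<longlonglongrightarrow> blinfun_apply \<psi> y" and e: "0 < e"
  shows "\<forall>\<^sub>F n in sequentially. norm (c - \<psi>) - e \<le> norm (c - \<phi> n)"
proof (cases "0 \<le> norm (c - \<psi>) - e")
  case True
  define b where "b = norm (c - \<psi>) - e"
  have b: "0 \<le> b" using True by (simp add: b_def)
  have "\<exists>y. b * norm y < norm (blinfun_apply (c - \<psi>) y)"
  proof (rule ccontr)
    assume "\<not> ?thesis"
    then have "norm (blinfun_apply (c - \<psi>) y) \<le> b * norm y" for y by (meson not_less)
    then have "norm (c - \<psi>) \<le> b" using b by (intro norm_blinfun_bound)
    then show False using e by (simp add: b_def)
  qed
  then obtain y where y: "b * norm y < norm (blinfun_apply (c - \<psi>) y)" by blast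
  have y0: "0 < norm y" using y by (cases "y = 0") (auto simp: blinfun.zero_right)
  have "(\<lambda>n. norm (blinfun_apply (c - \<phi> n) y)) \<longlonglongrightarrow> norm (blinfun_apply (c - \<psi>) y)"
    unfolding blinfun.diff_left by (intro tendsto_intros lim)
  then have "\<forall>\<^sub>F n in sequentially. b * norm y < norm (blinfun_apply (c - \<phi> n) y)"
    using y by (rule order_tendstoD)
  then show ?thesis
  proof eventually_elim
    case (elim n)
    also have "norm (blinfun_apply (c - \<phi> n) y) \<le> norm (c - \<phi> n) * norm y" by (rule norm_blinfun)
    finally show ?case using y0 by (simp add: b_def)
  qed
next
  case False
  then show ?thesis by (intro always_eventually) (smt (verit) norm_ge_zero)
qed

text \<open>
  A bounded subsequence of the values has a weak-star convergent one. Otherwise the values tend to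
  infinity; then the cells shrink so fast that the step functions tend weakly to zero on them,
  and zero serves as the limit value.
\<close>

lemma limit_value_subsequence:
  fixes \<phi> :: "nat \<Rightarrow> ('y::real_normed_vector \<Rightarrow>\<^sub>L real)"
  assumes sc: "seq_compactin weak_star (cball (0 :: 'y \<Rightarrow>\<^sub>L real) 1)" and p: "1 < p"
    and S: "\<And>n. S n \<in> sets M" and fin: "\<And>n. \<phi> n \<noteq> 0 \<Longrightarrow> emeasure M (S n) < \<infinity>"
    and bound: "\<And>n. norm (\<phi> n) powr p * measure M (S n) \<le> C"
  obtains r \<psi> where "strict_mono r"
    and "\<And>c e. 0 < e \<Longrightarrow> \<forall>\<^sub>F n in sequentially. norm (c - \<psi>) - e \<le> norm (c - \<phi> (r n))"
    and "\<And>B y. B \<in> sets M \<Longrightarrow> emeasure M B < \<infinity> \<Longrightarrow>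
           (\<lambda>n. (blinfun_apply (\<phi> (r n)) y - blinfun_apply \<psi> y) * measure M (S (r n) \<inter> B)) \<longlonglongrightarrow> 0"
proof (cases "\<exists>R. infinite {n. norm (\<phi> n) \<le> R}")
  case True
  then obtain R0 where "infinite {n. norm (\<phi> n) \<le> R0}" by blast
  then obtain r0 :: "nat \<Rightarrow> nat" where r0: "strict_mono r0" "\<And>n. norm (\<phi> (r0 n)) \<le> R0"
    using infinite_enumerate[of "{n. norm (\<phi> n) \<le> R0}"] by auto
  define R where "R = max R0 1"
  have R: "0 < R" by (simp add: R_def)
  let ?\<theta> = "\<lambda>n. inverse R *\<^sub>R \<phi> (r0 n)"
  have "norm (?\<theta> n) \<le> 1" for n
    using r0(2)[of n] R by (simp add: field_simps) (simp add: R_def)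
  then have "range ?\<theta> \<subseteq> cball 0 1" by (auto simp: dist_norm)
  then obtain l r1 where r1: "strict_mono r1" "limitin weak_star (?\<theta> \<circ> r1) l sequentially"
    using sc unfolding seq_compactin_def by blast
  let ?r = "r0 \<circ> r1"
  let ?\<psi> = "R *\<^sub>R l"
  have lim: "(\<lambda>n. blinfun_apply (\<phi> (?r n)) y) \<longlonglongrightarrow> blinfun_apply ?\<psi> y" for y
  proof -
    have "(\<lambda>n. R *\<^sub>R blinfun_apply (?\<theta> (r1 n)) y) \<longlonglongrightarrow> R *\<^sub>R blinfun_apply l y"
      using limitin_weak_star_apply[OF r1(2), of y]
      by (intro tendsto_scaleR tendsto_const) (simp only: o_def)
    moreover have "(\<lambda>n. R *\<^sub>R blinfun_apply (?\<theta> (r1 n)) y) = (\<lambda>n. blinfun_apply (\<phi> (?r n)) y)"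
      using R by (simp add: fun_eq_iff blinfun.scaleR_left)
    ultimately show ?thesis by (simp only: blinfun.scaleR_left)
  qed
  show thesis
  proof (rule that[of ?r ?\<psi>])
    show "strict_mono ?r" using r0(1) r1(1) by (rule strict_mono_o)
    show "\<forall>\<^sub>F n in sequentially. norm (c - ?\<psi>) - e \<le> norm (c - \<phi> (?r n))" if "0 < e" for c e
      using lim that by (rule weak_star_norm_diff_lsc)
    fix B y assume B: "B \<in> sets M" "emeasure M B < \<infinity>"
    show "(\<lambda>n. (blinfun_apply (\<phi> (?r n)) y - blinfun_apply ?\<psi> y) * measure M (S (?r n) \<inter> B)) \<longlonglongrightarrow> 0"
    proof (rule tendsto_0_le)
      show "(\<lambda>n. blinfun_apply (\<phi> (?r n)) y - blinfun_apply ?\<psi> y) \<longlonglongrightarrow> 0"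
        using lim by (rule LIM_zero)
      have "measure M (S (?r n) \<inter> B) \<le> measure M B" for n
        using B S by (intro measure_mono_fmeasurable) (auto simp: fmeasurable_def)
      then have "norm (a * measure M (S (?r n) \<inter> B)) \<le> norm a * measure M B" for n and a :: real
        by (simp add: abs_mult mult_left_mono)
      then show "\<forall>\<^sub>F n in sequentially.
          norm ((blinfun_apply (\<phi> (?r n)) y - blinfun_apply ?\<psi> y) * measure M (S (?r n) \<inter> B))
          \<le> norm (blinfun_apply (\<phi> (?r n)) y - blinfun_apply ?\<psi> y) * measure M B"
        by (intro always_eventually allI)
    qed
  qed
next
  case False
  have top: "filterlim (\<lambda>n. norm (\<phi> n)) at_top sequentially"
    unfolding filterlim_at_top
  proof
    fix Z
    have "finite {n. norm (\<phi> n) \<le> Z}" using False by blast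
    then have "\<forall>\<^sub>F n in cofinite. \<not> norm (\<phi> n) \<le> Z" by (simp add: eventually_cofinite)
    then show "\<forall>\<^sub>F n in sequentially. Z \<le> norm (\<phi> n)"
      unfolding cofinite_eq_sequentially by eventually_elim simp
  qed
  have lsc: "\<forall>\<^sub>F n in sequentially. norm (c - 0) - e \<le> norm (c - \<phi> n)" if "0 < e" for c e
  proof -
    have "\<forall>\<^sub>F n in sequentially. 2 * norm c \<le> norm (\<phi> n)" using top by (simp add: filterlim_at_top)
    then show ?thesis
    proof eventually_elim
      case (elim n)
      have "norm (\<phi> n) \<le> norm (c - \<phi> n) + norm c" by norm
      then show ?case using elim that by simp
    qed
  qed
  have weak: "(\<lambda>n. (blinfun_apply (\<phi> n) y - blinfun_apply 0 y) * measure M (S n \<inter> B)) \<longlonglongrightarrow> 0"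
    if B: "B \<in> sets M" for B y
  proof (rule tendsto_0_le)
    show "(\<lambda>n. norm (\<phi> n) powr (1 - p)) \<longlonglongrightarrow> 0" using p top by (intro tendsto_neg_powr) auto
    have "\<forall>\<^sub>F n in sequentially. 1 \<le> norm (\<phi> n)" using top by (simp add: filterlim_at_top)
    then show "\<forall>\<^sub>F n in sequentially.
        norm ((blinfun_apply (\<phi> n) y - blinfun_apply 0 y) * measure M (S n \<inter> B))
        \<le> norm (norm (\<phi> n) powr (1 - p)) * (C * norm y)"
    proof eventually_elim
      case (elim n)
      then have nz: "\<phi> n \<noteq> 0" by auto
      have "norm ((blinfun_apply (\<phi> n) y - blinfun_apply 0 y) * measure M (S n \<inter> B))
          = norm (blinfun_apply (\<phi> n) y) * measure M (S n \<inter> B)" by (simp add: abs_mult)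
      also have "\<dots> \<le> (norm (\<phi> n) * norm y) * measure M (S n)"
        using S B fin[OF nz]
        by (intro mult_mono norm_blinfun measure_mono_fmeasurable) (auto simp: fmeasurable_def)
      also have "norm (\<phi> n) = norm (\<phi> n) powr (1 - p) * norm (\<phi> n) powr p"
        using nz by (simp flip: powr_add)
      also have "norm (\<phi> n) powr (1 - p) * norm (\<phi> n) powr p * norm y * measure M (S n)
          = norm (\<phi> n) powr (1 - p) * (norm (\<phi> n) powr p * measure M (S n) * norm y)" by simp
      also have "\<dots> \<le> norm (\<phi> n) powr (1 - p) * (C * norm y)"
        using bound[of n] by (intro mult_left_mono mult_right_mono) auto
      finally show ?case by simp
    qed
  qed
  show thesis by (rule that[of id 0]) (use lsc weak in \<open>auto simp: strict_mono_def\<close>)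
qed

lemma finite_simultaneous_subsequence:
  fixes P :: "nat \<Rightarrow> (nat \<Rightarrow> nat) \<Rightarrow> bool"
  assumes ex: "\<And>i r. i < k \<Longrightarrow> strict_mono r \<Longrightarrow> \<exists>s::nat \<Rightarrow> nat. strict_mono s \<and> P i (r \<circ> s)"
    and sub: "\<And>i r s. P i r \<Longrightarrow> strict_mono s \<Longrightarrow> P i (r \<circ> s)"
  shows "\<exists>r. strict_mono r \<and> (\<forall>i<k. P i r)"
  using ex
proof (induction k)
  case 0
  show ?case by (intro exI[of _ id]) (auto simp: strict_mono_def)
next
  case (Suc k)
  then obtain r where r: "strict_mono r" "\<And>i. i < k \<Longrightarrow> P i r" by (metis less_Suc_eq)
  obtain s where s: "strict_mono s" "P k (r \<circ> s)" using Suc.prems[of k r] r(1) by blast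
  have "strict_mono (r \<circ> s)" using r(1) s(1) by (rule strict_mono_o)
  moreover have "P i (r \<circ> s)" if "i < Suc k" for i
    using that s r(2) sub by (cases "i = k") auto
  ultimately show ?case by blast
qed

text \<open>
  The second claim is the inequality of Young for \<open>\<delta> * norm (\<phi> w)\<close> and \<open>norm (h w) / \<delta>\<close>. With a
  small \<open>\<delta>\<close>, the contribution of a bounded family of \<open>\<phi>\<close> is small uniformly, and that of \<open>h\<close>
  is small once \<open>h\<close> is small enough.
\<close>

lemma integrable_pairing:
  fixes \<phi> :: "'a \<Rightarrow> ('y::real_normed_vector \<Rightarrow>\<^sub>L real)"
  assumes pq: "1 < p" "1 < q" "1 / p + 1 / q = 1" and \<phi>: "\<phi> \<in> Lp M p" and h: "h \<in> Lp M q"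
  shows "integrable M (\<lambda>w. blinfun_apply (\<phi> w) (h w))"
    and "0 < \<delta> \<Longrightarrow> \<bar>\<integral>w. blinfun_apply (\<phi> w) (h w) \<partial>M\<bar>
           \<le> \<delta> powr p * (\<integral>w. norm (\<phi> w) powr p \<partial>M) + \<delta> powr - q * (\<integral>w. norm (h w) powr q \<partial>M)"
proof -
  have \<phi>': "strongly_measurable M \<phi>" "integrable M (\<lambda>w. norm (\<phi> w) powr p)"
    and h': "strongly_measurable M h" "integrable M (\<lambda>w. norm (h w) powr q)"
    using \<phi> h pq by (auto simp: Lp_iff_integrable)
  have div_le: "t / r \<le> t" if "0 \<le> t" "1 < r" for t r :: real
    using that mult_left_mono[of 1 r t] by (simp add: divide_le_eq)
  have le: "\<bar>blinfun_apply (\<phi> w) (h w)\<bar> \<le> \<delta> powr p * norm (\<phi> w) powr p + \<delta> powr - q * norm (h w) powr q"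
    if \<delta>: "0 < \<delta>" for \<delta> w
  proof -
    have "\<bar>blinfun_apply (\<phi> w) (h w)\<bar> \<le> norm (\<phi> w) * norm (h w)"
      using norm_blinfun[of "\<phi> w" "h w"] by simp
    also have "\<dots> = (\<delta> * norm (\<phi> w)) * (inverse \<delta> * norm (h w))" using \<delta> by simp
    also have "\<dots> \<le> (\<delta> * norm (\<phi> w)) powr p / p + (inverse \<delta> * norm (h w)) powr q / q"
      using pq \<delta> by (intro Youngs_inequality) auto
    also have "\<dots> \<le> (\<delta> * norm (\<phi> w)) powr p + (inverse \<delta> * norm (h w)) powr q"
      using pq div_le by (intro add_mono) auto
    also have "\<dots> = \<delta> powr p * norm (\<phi> w) powr p + \<delta> powr - q * norm (h w) powr q"
      using \<delta> by (simp add: powr_mult inverse_powr powr_minus)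
    finally show ?thesis .
  qed
  have bound: "integrable M (\<lambda>w. \<delta> powr p * norm (\<phi> w) powr p + \<delta> powr - q * norm (h w) powr q)" for \<delta>
    using \<phi>'(2) h'(2) by auto
  show int: "integrable M (\<lambda>w. blinfun_apply (\<phi> w) (h w))"
  proof (rule Bochner_Integration.integrable_bound[OF bound[of 1]])
    show "(\<lambda>w. blinfun_apply (\<phi> w) (h w)) \<in> borel_measurable M"
      using \<phi>'(1) h'(1) by (rule strongly_measurable_pairing)
  qed (use le[of 1] in auto)
  show "\<bar>\<integral>w. blinfun_apply (\<phi> w) (h w) \<partial>M\<bar>
      \<le> \<delta> powr p * (\<integral>w. norm (\<phi> w) powr p \<partial>M) + \<delta> powr - q * (\<integral>w. norm (h w) powr q \<partial>M)"
    if \<delta>: "0 < \<delta>"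
  proof -
    have "\<bar>\<integral>w. blinfun_apply (\<phi> w) (h w) \<partial>M\<bar> \<le> (\<integral>w. \<bar>blinfun_apply (\<phi> w) (h w)\<bar> \<partial>M)"
      by (rule integral_abs_bound)
    also have "\<dots> \<le> (\<integral>w. \<delta> powr p * norm (\<phi> w) powr p + \<delta> powr - q * norm (h w) powr q \<partial>M)"
      using int bound le[OF \<delta>] by (intro integral_mono) auto
    also have "\<dots> = \<delta> powr p * (\<integral>w. norm (\<phi> w) powr p \<partial>M) + \<delta> powr - q * (\<integral>w. norm (h w) powr q \<partial>M)"
      using \<phi>'(2) h'(2) by simp
    finally show ?thesis .
  qed
qed

lemma integral_pairing_simple:
  fixes \<phi> :: "'a \<Rightarrow> ('y::real_normed_vector \<Rightarrow>\<^sub>L real)"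
  assumes pq: "1 < p" "1 < q" "1 / p + 1 / q = 1" and \<phi>: "\<phi> \<in> Lp M p"
    and s: "simple_function M s" "s \<in> Lp M q"
  shows "(\<integral>w. blinfun_apply (\<phi> w) (s w) \<partial>M)
           = (\<Sum>v\<in>s ` space M - {0}. \<integral>w. indicator (s -` {v} \<inter> space M) w * blinfun_apply (\<phi> w) v \<partial>M)"
proof -
  let ?V = "s ` space M - {0}"
  have V: "finite ?V" using simple_functionD(1)[OF s(1)] by blast
  have eq: "blinfun_apply (\<phi> w) (s w)
      = (\<Sum>v\<in>?V. indicator (s -` {v} \<inter> space M) w * blinfun_apply (\<phi> w) v)" if w: "w \<in> space M" for w
  proof -
    have "(\<Sum>v\<in>?V. indicator (s -` {v} \<inter> space M) w * blinfun_apply (\<phi> w) v)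
        = (\<Sum>v\<in>?V. if v = s w then blinfun_apply (\<phi> w) (s w) else 0)"
      using w by (intro sum.cong) (auto simp: indicator_def)
    then show ?thesis using V w by (cases "s w = 0") (auto simp: blinfun.zero_right)
  qed
  have int: "integrable M (\<lambda>w. indicator (s -` {v} \<inter> space M) w * blinfun_apply (\<phi> w) v)"
    if "v \<in> ?V" for v
  proof -
    have sets: "s -` {v} \<inter> space M \<in> sets M" using s(1) by (rule simple_functionD)
    have "integrable M (\<lambda>w. blinfun_apply (\<phi> w) (s w) * indicator (s -` {v} \<inter> space M) w)"
      using sets integrable_pairing(1)[OF pq \<phi> s(2)] by (rule integrable_real_mult_indicator)
    then show ?thesis
      by (rule Bochner_Integration.integrable_cong[THEN iffD1, rotated -1]) (auto simp: indicator_def)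
  qed
  have "(\<integral>w. blinfun_apply (\<phi> w) (s w) \<partial>M)
      = (\<integral>w. (\<Sum>v\<in>?V. indicator (s -` {v} \<inter> space M) w * blinfun_apply (\<phi> w) v) \<partial>M)"
    using eq by (intro Bochner_Integration.integral_cong) auto
  then show ?thesis using int by (simp add: Bochner_Integration.integral_sum)
qed

text \<open>
  By boundedness of \<open>g\<close> it is enough to test with a dense set of \<open>h\<close>, and the simple functions in
  \<open>Lp M q\<close> are finite combinations of constants on sets of finite measure.
\<close>

lemma pairing_tendsto:
  fixes g :: "nat \<Rightarrow> 'a \<Rightarrow> ('y::real_normed_vector \<Rightarrow>\<^sub>L real)"
  assumes pq: "1 < p" "1 < q" "1 / p + 1 / q = 1"
    and g: "\<And>n. g n \<in> Lp M p" and u: "u \<in> Lp M p" and h: "h \<in> Lp M q"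
    and bound: "\<And>n. (\<integral>w. norm (g n w) powr p \<partial>M) \<le> C"
    and conv: "\<And>B y. B \<in> sets M \<Longrightarrow> emeasure M B < \<infinity> \<Longrightarrow>
          (\<lambda>n. \<integral>w. indicator B w * blinfun_apply (g n w) y \<partial>M)
            \<longlonglongrightarrow> (\<integral>w. indicator B w * blinfun_apply (u w) y \<partial>M)"
  shows "(\<lambda>n. \<integral>w. blinfun_apply (g n w) (h w) \<partial>M) \<longlonglongrightarrow> (\<integral>w. blinfun_apply (u w) (h w) \<partial>M)"
proof (rule LIMSEQ_I)
  fix e :: real assume e: "0 < e"
  have q0: "0 < q" using pq by simp
  define K where "K = max (max C (\<integral>w. norm (u w) powr p \<partial>M)) 0"
  have K0: "0 \<le> K" by (simp add: K_def)
  have K: "(\<integral>w. norm (g n w) powr p \<partial>M) \<le> K" "(\<integral>w. norm (u w) powr p \<partial>M) \<le> K" for n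
    using bound[of n] by (auto simp: K_def)
  \<comment> \<open>Chosen so that the first term in the bound of \<open>integrable_pairing\<close> is at most \<open>e / 8\<close>.\<close>
  define \<delta> where "\<delta> = (e / (8 * (K + 1))) powr (1 / p)"
  have \<delta>0: "0 < \<delta>" using e K0 by (simp add: \<delta>_def)
  have \<delta>: "\<delta> powr p * K \<le> e / 8"
  proof -
    have eq: "\<delta> powr p = e / (8 * (K + 1))" using e K0 pq by (simp add: \<delta>_def powr_powr)
    have "\<delta> powr p * K = e / 8 * (K / (K + 1))" unfolding eq by simp
    also have "\<dots> \<le> e / 8 * 1" using e K0 by (intro mult_left_mono) auto
    finally show ?thesis by simp
  qed
  have h': "strongly_measurable M h" "integrable M (\<lambda>w. 1 * norm (h w) powr q)"
    using h q0 by (auto simp: Lp_iff_integrable)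
  have "0 < e / 8 * \<delta> powr q" using e \<delta>0 by simp
  then obtain s where s: "simple_function M s" "\<And>w. norm (s w) \<le> 2 * norm (h w)"
      "integrable M (\<lambda>w. 1 * norm (h w - s w) powr q)"
      "(\<integral>w. 1 * norm (h w - s w) powr q \<partial>M) < e / 8 * \<delta> powr q"
    using simple_approximation[where \<psi> = "\<lambda>_. 1", OF h'(1) q0 zero_le_one borel_measurable_const h'(2)]
    by blast
  have sm: "strongly_measurable M s" using s(1) by (rule strongly_measurable_simple)
  have [measurable]: "(\<lambda>w. norm (s w)) \<in> borel_measurable M" using sm by (rule strongly_measurable_norm)
  have "integrable M (\<lambda>w. norm (s w) powr q)"
  proof (rule Bochner_Integration.integrable_bound)
    show "integrable M (\<lambda>w. 2 powr q * norm (h w) powr q)" using h'(2) by simp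
    show "AE w in M. norm (norm (s w) powr q) \<le> norm (2 powr q * norm (h w) powr q)"
      using powr_mono2[OF _ _ s(2), of q] q0 by (auto simp: powr_mult)
  qed measurable
  then have sq: "s \<in> Lp M q" using sm q0 by (simp add: Lp_iff_integrable)
  have dq: "(\<lambda>w. h w - s w) \<in> Lp M q"
    using h'(1) sm s(3) q0 by (simp add: Lp_iff_integrable strongly_measurable_diff)
  have rest: "\<bar>\<integral>w. blinfun_apply (\<phi> w) (h w) \<partial>M - (\<integral>w. blinfun_apply (\<phi> w) (s w) \<partial>M)\<bar> \<le> e / 4"
    if \<phi>: "\<phi> \<in> Lp M p" "(\<integral>w. norm (\<phi> w) powr p \<partial>M) \<le> K" for \<phi> :: "'a \<Rightarrow> ('y \<Rightarrow>\<^sub>L real)"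
  proof -
    have "(\<integral>w. blinfun_apply (\<phi> w) (h w) \<partial>M) - (\<integral>w. blinfun_apply (\<phi> w) (s w) \<partial>M)
        = (\<integral>w. blinfun_apply (\<phi> w) (h w - s w) \<partial>M)"
      unfolding blinfun.diff_right
      using integrable_pairing(1)[OF pq \<phi>(1)] h sq
      by (intro Bochner_Integration.integral_diff[symmetric]) auto
    also have "\<bar>\<dots>\<bar> \<le> \<delta> powr p * (\<integral>w. norm (\<phi> w) powr p \<partial>M)
                         + \<delta> powr - q * (\<integral>w. norm (h w - s w) powr q \<partial>M)"
      using integrable_pairing(2)[OF pq \<phi>(1) dq \<delta>0] .
    also have "\<delta> powr p * (\<integral>w. norm (\<phi> w) powr p \<partial>M) \<le> \<delta> powr p * K"
      using \<phi>(2) by (intro mult_left_mono) auto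
    also have "\<delta> powr - q * (\<integral>w. norm (h w - s w) powr q \<partial>M) \<le> \<delta> powr - q * (e / 8 * \<delta> powr q)"
      using s(4) by (intro mult_left_mono) auto
    also have "\<delta> powr - q * (e / 8 * \<delta> powr q) = e / 8" using \<delta>0 by (simp add: powr_minus)
    finally show ?thesis using \<delta> by simp
  qed
  have "(\<lambda>n. \<integral>w. blinfun_apply (g n w) (s w) \<partial>M) \<longlonglongrightarrow> (\<integral>w. blinfun_apply (u w) (s w) \<partial>M)"
    unfolding integral_pairing_simple[OF pq g s(1) sq] integral_pairing_simple[OF pq u s(1) sq]
  proof (rule tendsto_sum)
    fix v assume v: "v \<in> s ` space M - {0}"
    have sets: "s -` {v} \<inter> space M \<in> sets M" using s(1) by (rule simple_functionD)
    have "emeasure M (s -` {v} \<inter> space M) < \<infinity>"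
      using v by (intro cell_measure_bound(1)[OF q0 sq sets, of v]) auto
    with sets show "(\<lambda>n. \<integral>w. indicator (s -` {v} \<inter> space M) w * blinfun_apply (g n w) v \<partial>M)
        \<longlonglongrightarrow> (\<integral>w. indicator (s -` {v} \<inter> space M) w * blinfun_apply (u w) v \<partial>M)" by (rule conv)
  qed
  from LIMSEQ_D[OF this, of "e / 4"] e obtain N where N: "\<And>n. N \<le> n \<Longrightarrow>
      \<bar>(\<integral>w. blinfun_apply (g n w) (s w) \<partial>M) - (\<integral>w. blinfun_apply (u w) (s w) \<partial>M)\<bar> < e / 4"
    by auto
  have "norm ((\<integral>w. blinfun_apply (g n w) (h w) \<partial>M) - (\<integral>w. blinfun_apply (u w) (h w) \<partial>M)) < e"
    if "N \<le> n" for n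
    using N[OF that] rest[OF g K(1), of n] rest[OF u K(2)] e unfolding real_norm_def by linarith
  then show "\<exists>N. \<forall>n\<ge>N. norm ((\<integral>w. blinfun_apply (g n w) (h w) \<partial>M)
                              - (\<integral>w. blinfun_apply (u w) (h w) \<partial>M)) < e" by blast
qed

text \<open>
  A convergent subsequence is a convergent subnet, and the weak-star topology of \<open>Lp\<close> is the
  topology of convergence of all pairings.
\<close>

lemma weak_star_subnet_of_subsequence:
  fixes g :: "nat \<Rightarrow> 'a \<Rightarrow> ('y::real_normed_vector \<Rightarrow>\<^sub>L real)"
  assumes r: "strict_mono r" and g: "\<And>n. g n \<in> Lp M p" and u: "u \<in> Lp M p"
    and conv: "\<And>h. h \<in> Lp M q \<Longrightarrow>
          (\<lambda>n. \<integral>w. blinfun_apply (g (r n) w) (h w) \<partial>M) \<longlonglongrightarrow> (\<integral>w. blinfun_apply (u w) (h w) \<partial>M)"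
  shows "has_subnet_converging_to (Lp_weak_star M p q) g u"
proof (rule has_subnet_converging_toI)
  let ?\<Phi> = "\<lambda>\<phi>. \<lambda>h\<in>Lp M q. \<integral>w. blinfun_apply (\<phi> w) (h w) \<partial>M"
  let ?P = "product_topology (\<lambda>_. euclideanreal) (Lp M q)"
  have lim: "limitin ?P (\<lambda>n. ?\<Phi> (g (r n))) (?\<Phi> u) sequentially"
    unfolding limitin_componentwise by (auto simp: conv)
  show "subnet_converges UNIV (\<le>) r (Lp_weak_star M p q) g u"
    unfolding subnet_converges_def
  proof (intro conjI allI impI)
    have "\<exists>c. a \<le> c \<and> b \<le> c" for a b :: nat by (rule exI[of _ "max a b"]) simp
    then show "directed_by UNIV ((\<le>) :: nat \<Rightarrow> nat \<Rightarrow> bool)"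
      unfolding directed_by_def by auto
    show "\<exists>d0\<in>UNIV. \<forall>d\<in>UNIV. d0 \<le> d \<longrightarrow> N \<le> r d" for N
      using seq_suble[OF r] by (metis order_trans UNIV_I)
    show "u \<in> topspace (Lp_weak_star M p q)"
      unfolding Lp_weak_star_def topspace_pullback_topology using u by auto
    fix U assume U: "openin (Lp_weak_star M p q) U \<and> u \<in> U"
    then obtain V where V: "openin ?P V" "U = ?\<Phi> -` V \<inter> Lp M p"
      unfolding Lp_weak_star_def openin_pullback_topology by blast
    have "\<forall>\<^sub>F n in sequentially. ?\<Phi> (g (r n)) \<in> V" using lim V U unfolding limitin_def by blast
    then have "\<forall>\<^sub>F n in sequentially. g (r n) \<in> U" by eventually_elim (use V(2) g in auto)
    then show "\<exists>d0\<in>UNIV. \<forall>d\<in>UNIV. d0 \<le> d \<longrightarrow> g (r d) \<in> U"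
      by (auto simp: eventually_sequentially)
  qed
qed

section \<open>Approximative compactness\<close>

text \<open>Empty cells fill a decomposition up to exactly \<open>k\<close> cells.\<close>

lemma G_set_cells:
  assumes "g \<in> G_set M p k"
  obtains A X where "\<And>i. i < k \<Longrightarrow> A i \<in> sets M" "disjoint_family_on A {..<k}"
    and "(\<Union>i<k. A i) = space M" "\<And>i w. i < k \<Longrightarrow> w \<in> A i \<Longrightarrow> g w = X i"
proof -
  obtain l A x where l: "l \<le> k" and A: "\<forall>i<l. A i \<in> sets M" "disjoint_family_on A {..<l}"
      "(\<Union>i<l. A i) = space M" "\<forall>w\<in>space M. g w = (\<Sum>i<l. indicator (A i) w *\<^sub>R x i)"
    using assms unfolding G_set_def by blast
  let ?A = "\<lambda>i. if i < l then A i else {}"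
  show thesis
  proof
    show "?A i \<in> sets M" for i using A(1) by simp
    show "disjoint_family_on ?A {..<k}" using A(2) by (auto simp: disjoint_family_on_def)
    show "(\<Union>i<k. ?A i) = space M"
    proof -
      have "(\<Union>i<k. ?A i) = (\<Union>i<l. A i)" using l by (auto split: if_splits) fastforce
      then show ?thesis using A(3) by simp
    qed
    fix i w assume "i < k" and "w \<in> ?A i"
    then have i: "i < l" "w \<in> A i" by (auto split: if_splits)
    have "indicator (A j) w *\<^sub>R x j = (if j = i then x i else 0)" if "j < l" for j
      using A(2) i that by (auto simp: disjoint_family_on_def indicator_def)
    then have "(\<Sum>j<l. indicator (A j) w *\<^sub>R x j) = (\<Sum>j<l. if j = i then x i else 0)"
      by (intro sum.cong) auto
    moreover have "w \<in> space M" using i A(3) by blast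
    ultimately show "g w = x i" using A(4) i(1) by simp
  qed
qed

theorem theorem1p2:
  fixes M :: "'a measure" and p q :: real and k :: nat
  assumes "1 < p" and "1 / p + 1 / q = 1"
    and "1 \<le> k"
    and "RNP TYPE('a) TYPE('y::banach \<Rightarrow>\<^sub>L real)"
    and "RNP TYPE(real) TYPE('y \<Rightarrow>\<^sub>L real)"
    and "seq_compactin weak_star (cball (0 :: 'y \<Rightarrow>\<^sub>L real) 1)"
    and "gateaux_differentiable_norm TYPE('y \<Rightarrow>\<^sub>L real)"
  shows "approximatively_compact (Lp M p) (Lp_dist M p) (Lp_weak_star M p q)
           (G_set M p k :: ('a \<Rightarrow> ('y \<Rightarrow>\<^sub>L real)) set)"
  unfolding approximatively_compact_def
proof (intro conjI ballI allI impI)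
  show "(G_set M p k :: ('a \<Rightarrow> ('y \<Rightarrow>\<^sub>L real)) set) \<subseteq> Lp M p" unfolding G_set_def by blast
next
  fix f :: "'a \<Rightarrow> ('y \<Rightarrow>\<^sub>L real)" and g :: "nat \<Rightarrow> 'a \<Rightarrow> ('y \<Rightarrow>\<^sub>L real)"
  assume f: "f \<in> Lp M p" and min: "minimizing_sequence (Lp_dist M p) (G_set M p k) f g"
  note p = assms(1) and sc = assms(6) and G = assms(7)
  have p0: "0 < p" and k: "0 < k" using assms(1,3) by auto
  have q: "1 < q"
  proof -
    have "0 < 1 / p" "1 / p < 1" using p by auto
    then have "0 < 1 / q" "1 / q < 1" using assms(2) by linarith+
    then show ?thesis by (simp add: zero_less_divide_iff divide_less_eq_1)
  qed
  define D where "D = (INF u\<in>G_set M p k. Lp_dist M p f u) powr p"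
  have gG: "g n \<in> G_set M p k" for n using min by (simp add: minimizing_sequence_def)
  then have gL: "g n \<in> Lp M p" for n unfolding G_set_def by blast
  have cost: "(\<lambda>n. \<integral>w. norm (f w - g n w) powr p \<partial>M) \<longlonglongrightarrow> D"
  proof -
    have "(\<lambda>n. Lp_dist M p f (g n) powr p) \<longlonglongrightarrow> D"
      unfolding D_def using min p0 Lp_dist_nonneg
      by (intro tendsto_powr2 always_eventually allI) (auto simp: minimizing_sequence_def)
    then show ?thesis by (simp add: Lp_dist_powr[OF p0])
  qed
  obtain C where C: "\<And>n. (\<integral>w. norm (g n w) powr p \<partial>M) \<le> C"
  proof -
    obtain C0 where C0: "\<And>n. norm (\<integral>w. norm (f w - g n w) powr p \<partial>M) \<le> C0"
      using convergent_imp_Bseq[OF convergentI[OF cost]] unfolding Bseq_def by blast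
    have fi: "integrable M (\<lambda>w. norm (f w) powr p)" using f p0 by (simp add: Lp_iff_integrable)
    have "(\<integral>w. norm (g n w) powr p \<partial>M) \<le> 2 powr p * ((\<integral>w. norm (f w) powr p \<partial>M) + C0)" for n
    proof -
      have gi: "integrable M (\<lambda>w. norm (g n w) powr p)" using gL p0 by (simp add: Lp_iff_integrable)
      have di: "integrable M (\<lambda>w. norm (f w - g n w) powr p)"
        using p0 f gL by (rule integrable_norm_diff_powr)
      have le: "norm (g n w) powr p \<le> 2 powr p * (norm (f w) powr p + norm (f w - g n w) powr p)" for w
        using norm_diff_powr_le[of p "f w" "f w - g n w"] p0 by simp
      have "(\<integral>w. norm (g n w) powr p \<partial>M)
          \<le> (\<integral>w. 2 powr p * (norm (f w) powr p + norm (f w - g n w) powr p) \<partial>M)"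
        using gi fi di le by (intro integral_mono) auto
      also have "\<dots> = 2 powr p * ((\<integral>w. norm (f w) powr p \<partial>M)
                                  + (\<integral>w. norm (f w - g n w) powr p \<partial>M))"
        using fi di by simp
      also have "\<dots> \<le> 2 powr p * ((\<integral>w. norm (f w) powr p \<partial>M) + C0)"
        using C0[of n] by (intro mult_left_mono) auto
      finally show ?thesis .
    qed
    then show thesis by (rule that)
  qed
  have "\<exists>A X. (\<forall>i<k. A i \<in> sets M) \<and> disjoint_family_on A {..<k} \<and> (\<Union>i<k. A i) = space M \<and>
          (\<forall>i<k. \<forall>w\<in>A i. g n w = X i)" for n
    using G_set_cells[OF gG[of n]] by metis
  then obtain A X where A: "\<And>n i. i < k \<Longrightarrow> A n i \<in> sets M" "\<And>n. disjoint_family_on (A n) {..<k}"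
      "\<And>n. (\<Union>i<k. A n i) = space M" and X: "\<And>n i w. i < k \<Longrightarrow> w \<in> A n i \<Longrightarrow> g n w = X n i"
    by metis
  define Q where "Q i r \<psi> \<longleftrightarrow>
      (\<forall>c e. 0 < e \<longrightarrow> (\<forall>\<^sub>F n in sequentially. norm (c - \<psi>) - e \<le> norm (c - X (r n) i))) \<and>
      (\<forall>B y. B \<in> sets M \<longrightarrow> emeasure M B < \<infinity> \<longrightarrow>
         (\<lambda>n. (blinfun_apply (X (r n) i) y - blinfun_apply \<psi> y) * measure M (A (r n) i \<inter> B))
           \<longlonglongrightarrow> 0)" for i and r :: "nat \<Rightarrow> nat" and \<psi>
  have "\<exists>r. strict_mono r \<and> (\<forall>i<k. \<exists>\<psi>. Q i r \<psi>)"
  proof (rule finite_simultaneous_subsequence)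
    fix i and r :: "nat \<Rightarrow> nat" assume i: "i < k"
    have cell: "emeasure M (A n i) < \<infinity>" "norm (X n i) powr p * measure M (A n i) \<le> C"
      if "X n i \<noteq> 0" for n
    proof -
      have val: "g n w = X n i" if "w \<in> A n i" for w using X[OF i that] .
      show "emeasure M (A n i) < \<infinity>" "norm (X n i) powr p * measure M (A n i) \<le> C"
        using cell_measure_bound[OF p0 gL A(1)[OF i, of n] val that] C[of n] by auto
    qed
    have "0 \<le> C" using C[of 0] by (rule order_trans[rotated]) simp
    then have bound: "norm (X n i) powr p * measure M (A n i) \<le> C" for n
      using cell(2)[of n] by (cases "X n i = 0") auto
    obtain s \<psi> where s: "strict_mono s"
      and lsc: "\<And>c e. 0 < e \<Longrightarrow>
             \<forall>\<^sub>F n in sequentially. norm (c - \<psi>) - e \<le> norm (c - X (r (s n)) i)"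
      and weak: "\<And>B y. B \<in> sets M \<Longrightarrow> emeasure M B < \<infinity> \<Longrightarrow>
             (\<lambda>n. (blinfun_apply (X (r (s n)) i) y - blinfun_apply \<psi> y)
                    * measure M (A (r (s n)) i \<inter> B)) \<longlonglongrightarrow> 0"
      using limit_value_subsequence[OF sc p, where S = "\<lambda>n. A (r n) i" and \<phi> = "\<lambda>n. X (r n) i"
          and M = M and C = C] A(1)[OF i] cell(1) bound by blast
    have "Q i (r \<circ> s) \<psi>" unfolding Q_def using lsc weak by auto
    then show "\<exists>s. strict_mono s \<and> (\<exists>\<psi>. Q i (r \<circ> s) \<psi>)" using s by blast
  next
    fix i and r s :: "nat \<Rightarrow> nat" assume Q: "\<exists>\<psi>. Q i r \<psi>" and s: "strict_mono s"
    have top: "filterlim s sequentially sequentially" using s by (rule filterlim_subseq)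
    obtain \<psi> where
        lsc: "\<And>c e. 0 < e \<Longrightarrow> \<forall>\<^sub>F n in sequentially. norm (c - \<psi>) - e \<le> norm (c - X (r n) i)"
      and weak: "\<And>B y. B \<in> sets M \<Longrightarrow> emeasure M B < \<infinity> \<Longrightarrow>
         (\<lambda>n. (blinfun_apply (X (r n) i) y - blinfun_apply \<psi> y) * measure M (A (r n) i \<inter> B))
           \<longlonglongrightarrow> 0"
      using Q unfolding Q_def by blast
    show "\<exists>\<psi>. Q i (r \<circ> s) \<psi>"
      unfolding Q_def o_apply
    proof (intro exI[of _ \<psi>] conjI allI impI)
      show "\<forall>\<^sub>F n in sequentially. norm (c - \<psi>) - e \<le> norm (c - X (r (s n)) i)" if "0 < e" for c e
        using eventually_compose_filterlim[OF lsc[OF that] top] .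
      show "(\<lambda>n. (blinfun_apply (X (r (s n)) i) y - blinfun_apply \<psi> y)
               * measure M (A (r (s n)) i \<inter> B)) \<longlonglongrightarrow> 0"
        if "B \<in> sets M" "emeasure M B < \<infinity>" for B y
        using filterlim_compose[OF weak[OF that] top] .
    qed
  qed
  then obtain r where r: "strict_mono r" "\<forall>i<k. \<exists>\<psi>. Q i r \<psi>" by blast
  from r(2) obtain x where x: "\<And>i. i < k \<Longrightarrow> Q i r (x i)" by metis
  have lsc: "\<forall>\<^sub>F n in sequentially. norm (c - x i) - e \<le> norm (c - X (r n) i)"
    if "i < k" "0 < e" for i c e
    using x[OF that(1)] that(2) unfolding Q_def by blast
  have weak: "(\<lambda>n. (blinfun_apply (X (r n) i) y - blinfun_apply (x i) y)
                     * measure M (A (r n) i \<inter> B)) \<longlonglongrightarrow> 0"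
    if "i < k" "B \<in> sets M" "emeasure M B < \<infinity>" for i B y
    using x[OF that(1)] that(2,3) unfolding Q_def by blast
  interpret minimizing_step_functions M p k f "\<lambda>n. A (r n)" "\<lambda>n. X (r n)" x "\<lambda>n. g (r n)" D
  proof
    show "(\<lambda>n. \<integral>w. norm (f w - g (r n) w) powr p \<partial>M) \<longlonglongrightarrow> D"
      using LIMSEQ_subseq_LIMSEQ[OF cost r(1)] by (simp add: o_def)
    show "D \<le> (\<integral>w. nearest_cost p k f z w \<partial>M)" if "integrable M (nearest_cost p k f z)" for z
      unfolding D_def using p0 k f that by (rule infimum_le_nearest_cost)
  qed (use p k f gL A X lsc in auto)
  obtain u where u: "u \<in> G_set M p k"
      "\<And>w. w \<in> space M \<Longrightarrow> \<exists>i<k. u w = x i \<and> norm (f w - x i) powr p = nearest_cost p k f x w"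
    using nearest_step_function[OF p0 k f integrable_m] by blast
  have uL: "u \<in> Lp M p" using u(1) unfolding G_set_def by blast
  have "(\<lambda>n. \<integral>w. blinfun_apply (g (r n) w) (h w) \<partial>M) \<longlonglongrightarrow> (\<integral>w. blinfun_apply (u w) (h w) \<partial>M)"
    if h: "h \<in> Lp M q" for h
  proof (rule pairing_tendsto[OF p q assms(2) gL uL h C])
    fix B y assume B: "B \<in> sets M" "emeasure M B < \<infinity>"
    show "(\<lambda>n. \<integral>w. indicator B w * blinfun_apply (g (r n) w) y \<partial>M)
            \<longlonglongrightarrow> (\<integral>w. indicator B w * blinfun_apply (u w) y \<partial>M)"
    proof (rule integral_functional_tendsto[OF G B weak[OF _ B] u(2)])
      show "(\<lambda>w. blinfun_apply (u w) y) \<in> borel_measurable M"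
        using uL p0 by (intro strongly_measurable_pairing[where h = "\<lambda>_. y"])
          (auto simp: Lp_iff_integrable intro: strongly_measurable_simple)
    qed
  qed
  then have "has_subnet_converging_to (Lp_weak_star M p q) g u"
    by (rule weak_star_subnet_of_subsequence[OF r(1) gL uL])
  then show "\<exists>u\<in>G_set M p k. has_subnet_converging_to (Lp_weak_star M p q) g u"
    using u(1) by blast
qed

end
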